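(* Let $l$ be a positive integer, $j$ an integer, and $q\in\mathbb{C}$ with $0<|q|<1$. Then \begin{align*} &\frac{[-q^{l+j},q^{2l};q^{6l}]_\infty(q^{6l};q^{6l})^2_\infty} {[-q^{j},q^{l},-q^{2l+j};q^{6l}]_\infty} \bigg\{j + 2 \sum_{m=0}^\infty\bigg(\frac{ q^{6lm+l}}{1-q^{6lm+l}}-\frac{ q^{6lm+5l}}{1-q^{6lm+5l}}+\frac{ q^{6lm+l+j}}{1+q^{6lm+l+j}} \\ &\qquad -\frac{ q^{6lm+5l-j}}{1+q^{6lm+5l-j}} -2\frac{ q^{6lm+3l-j}}{1+q^{6lm+3l-j}}+2\frac{ q^{6lm+3l+j}}{1+q^{6lm+3l+j}}\bigg)\bigg\}\\ &=\sum_{n=-\infty}^\infty \frac{(6n+2+j)(-1)^nq^{3ln(n+1)+ln+l}}{1+q^{6ln+j+2l}} +\sum_{n=-\infty}^\infty \frac{(6n+j)(-1)^nq^{3ln(n+1)-ln}}{1+q^{6ln+j}}\\ &\quad+\frac{4(q^{2l};q^{2l})^2_\infty} {(q^{l};q^{2l})^2_\infty}\sum_{n=-\infty}^\infty \frac{(-1)^nq^{3ln(n+1)+2ln+2l}}{1+q^{6ln+j+3l}}. \end{align*}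
   Context: For $|p|<1$: $(a;p)_\infty=\prod_{k\ge 0}(1-ap^k)$, $(a_1,\dots,a_m;p)_\infty=(a_1;p)_\infty\cdots(a_m;p)_\infty$, and $[a_1,\dots,a_m;p]_\infty=(a_1,p/a_1,\dots,a_m,p/a_m;p)_\infty$. *)

theory Defs
  imports "HOL-Analysis.Analysis"
begin

(* (a;p)_inf, (a_1,...,a_m;p)_inf and [a_1,...,a_m;p]_inf, meaningful only for norm p < 1
   (the last one also needs all a_i nonzero, because of division by zero). *)

definition qpoch_inf1 :: "complex \<Rightarrow> complex \<Rightarrow> complex" where
  "qpoch_inf1 a p = (\<Prod>k. 1 - a * p ^ k)"

definition qpoch_inf :: "complex list \<Rightarrow> complex \<Rightarrow> complex" where
  "qpoch_inf as p = (\<Prod>a\<leftarrow>as. qpoch_inf1 a p)"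

definition qbracket_inf :: "complex list \<Rightarrow> complex \<Rightarrow> complex" where
  "qbracket_inf as p = qpoch_inf (concat (map (\<lambda>a. [a, p / a]) as)) p"

end

theory Submission
  imports Defs "HOL-Complex_Analysis.Complex_Analysis"
begin

text \<open>
  Put p = q^l and replace -q^j by a free variable y; write E(y) for the difference of the product side
  and the series side. The coefficient of j and the remaining part of the identity hold separately for all y.
  In the coefficient of j, both sides satisfy f(p^6 y) = - p y f(y) + const, and they have the same
  simple poles (at p^(6n) and p^(6n-2)) with the same residues. Hence E is holomorphic on the
  punctured plane and satisfies E(p^6 y) = - p y E(y) + K. Such a function is bounded near 0 and tends
  to 0 at infinity, so it vanishes by Liouville; in particular K = 0 without any evaluation of
  theta constants. The remaining part satisfies the same relation up to a multiple of the first
  difference, because the logarithmic derivative of the theta quotient drops by 3 under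
  y \<mapsto> p^6 y while the multipliers 6n + d drop by 6 under n \<mapsto> n - 1. Its residues
  at p^(6n-3) are what the eta quotient in front of the third series accounts for.
\<close>

section \<open>Functional equations of the form $f(Py) = b y f(y) + K$\<close>

text \<open>The factor y (rather than 1/y) in f(P y) = b y f(y) + K means theta degree -1. Comparing
  Laurent coefficients, any nonzero coefficient forces the others on one side to grow like
  P^(-n(n+1)/2), which no function holomorphic on the punctured plane allows. Hence agreement of the
  poles alone decides everything. In the theorem j occurs both as a number and inside q^j; only with
  these two roles separated, as \<open>J\<close> and \<open>y\<close>, do both parts become
  functions of y to which the argument applies. The linear multipliers match because the logarithmic
  sum equals 0 at y = 1 and 1 at y = p^(-2): twice these values are the multipliers 0 and 2 at n =
  0. The sum also has poles of its own. Those on the p^(-1) class are killed by zeros of the theta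
  quotient; those on the p^(-3) class survive and force a third series. Division by zero gives the
  functions default values at their poles, so equations are stated off the powers of p and extended
  by limits.\<close>

lemma bounded_near_zero_if_shift_bound:
  fixes h :: "complex \<Rightarrow> complex"
  assumes cont: "continuous_on (-{0}) h" and P: "P \<noteq> 0" "norm P < 1" and "0 \<le> \<beta>" "\<beta> < 1"
    and step: "\<And>u. u \<noteq> 0 \<Longrightarrow> norm u \<le> 1 \<Longrightarrow> norm (h (P * u)) \<le> \<beta> * norm (h u) + C"
  obtains B where "\<And>u. u \<noteq> 0 \<Longrightarrow> norm u \<le> 1 \<Longrightarrow> norm (h u) \<le> B"
proof -
  \<comment> \<open>A fundamental domain of u to P u: finitely many divisions by P bring every u
    with 0 < |u| <= 1 into this closed annulus.\<close>
  define A where "A = cball (0::complex) 1 - ball 0 (norm P)"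
  have "compact (h ` A)"
    using P by (intro compact_continuous_image continuous_on_subset[OF cont])
      (auto simp: A_def intro!: compact_diff)
  then obtain M where M: "\<And>u. u \<in> A \<Longrightarrow> norm (h u) \<le> M"
    by (meson bounded_iff compact_imp_bounded imageI)
  \<comment> \<open>C / (1 - \<beta>) is the fixed point of t to \<beta> t + C, so a bound at or
    above it survives every step inwards.\<close>
  define B where "B = max M (C / (1 - \<beta>))"
  have "\<beta> * B + C \<le> B"
  proof -
    have "C / (1 - \<beta>) \<le> B" by (simp add: B_def)
    then show ?thesis using \<open>\<beta> < 1\<close> by (simp add: divide_le_eq algebra_simps)
  qed
  have annuli: "norm (h u) \<le> B" if "norm P ^ Suc n \<le> norm u" "norm u \<le> 1" for n u
    using that
  proof (induction n arbitrary: u)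
    case 0
    then have "u \<in> A" by (auto simp: A_def)
    then show ?case using M[of u] by (simp add: B_def)
  next
    case (Suc n)
    show ?case
    proof (cases "norm P \<le> norm u")
      case True
      then have "u \<in> A" using Suc by (auto simp: A_def)
      then show ?thesis using M[of u] by (simp add: B_def)
    next
      case False
      define v where "v = u / P"
      have "0 < norm P ^ Suc (Suc n)" using P by simp
      then have "u \<noteq> 0" using Suc.prems by auto
      have u: "u = P * v" and v: "v \<noteq> 0" "norm v \<le> 1" "norm P ^ Suc n \<le> norm v"
        using False P Suc.prems \<open>u \<noteq> 0\<close> by (auto simp: v_def norm_divide field_simps)
      have "norm (h u) \<le> \<beta> * norm (h v) + C" unfolding u by (rule step) fact+
      also have "\<dots> \<le> \<beta> * B + C"
        using Suc.IH[OF v(3,2)] \<open>0 \<le> \<beta>\<close> by (intro add_right_mono mult_left_mono)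
      also have "\<dots> \<le> B" by fact
      finally show ?thesis .
    qed
  qed
  show ?thesis
  proof (rule that)
    fix u :: complex assume u: "u \<noteq> 0" "norm u \<le> 1"
    obtain n where "norm P ^ n < norm u"
      using real_arch_pow_inv[of "norm u" "norm P"] u P by auto
    moreover have "norm P ^ Suc n \<le> norm P ^ n"
      using P by (simp add: mult_left_le_one_le)
    ultimately show "norm (h u) \<le> B" using annuli[of n u] u by auto
  qed
qed

text \<open>Both hypotheses on b are contraction rates: |b| < 1 bounds f near 0, and in u = 1/y the
  equation reads g(P u) = (P/b) u (g(u) - K), so |P| < |b| bounds f near infinity.\<close>

lemma shift_equation_imp_zero:
  fixes f :: "complex \<Rightarrow> complex"
  assumes holo: "f holomorphic_on -{0}" and P: "P \<noteq> 0" "norm P < norm b" "norm b < 1"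
    and shift: "\<And>y. y \<noteq> 0 \<Longrightarrow> f (P * y) = b * y * f y + K"
  shows "y \<noteq> 0 \<Longrightarrow> f y = 0"
proof -
  have b: "b \<noteq> 0" and P1: "norm P < 1" using P by auto
  obtain B where B: "\<And>u. u \<noteq> 0 \<Longrightarrow> norm u \<le> 1 \<Longrightarrow> norm (f u) \<le> B"
  proof (rule bounded_near_zero_if_shift_bound[of f P "norm b" "norm K"])
    show "norm (f (P * u)) \<le> norm b * norm (f u) + norm K" if "u \<noteq> 0" "norm u \<le> 1" for u
    proof -
      have "norm (f (P * u)) \<le> norm (b * u * f u) + norm K"
        unfolding shift[OF that(1)] by (rule norm_triangle_ineq)
      also have "norm (b * u * f u) \<le> norm b * norm (f u)"
        using that mult_left_le[of "norm u" "norm b * norm (f u)"] by (simp add: norm_mult mult_ac)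
      finally show ?thesis by simp
    qed
  qed (use P P1 holo in \<open>auto intro: holomorphic_on_imp_continuous_on\<close>)
  define g where "g u = f (1 / u)" for u
  define b' where "b' = P / b"
  have b': "norm b' < 1" using P b by (simp add: b'_def norm_divide)
  have g_shift: "g (P * u) = b' * u * (g u - K)" if "u \<noteq> 0" for u
    using shift[of "1 / (P * u)"] that P b by (simp add: g_def b'_def field_simps)
  obtain B' where B': "\<And>u. u \<noteq> 0 \<Longrightarrow> norm u \<le> 1 \<Longrightarrow> norm (g u) \<le> B'"
  proof (rule bounded_near_zero_if_shift_bound[of g P "norm b'" "norm b' * norm K"])
    show "norm (g (P * u)) \<le> norm b' * norm (g u) + norm b' * norm K" if "u \<noteq> 0" "norm u \<le> 1" for u
    proof -
      have "norm (g (P * u)) \<le> norm b' * norm (g u - K)"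
        using that mult_left_le[of "norm u" "norm b' * norm (g u - K)"]
        by (simp add: g_shift norm_mult mult_ac)
      also have "\<dots> \<le> norm b' * (norm (g u) + norm K)"
        by (intro mult_left_mono norm_triangle_ineq4) auto
      finally show ?thesis by (simp add: algebra_simps)
    qed
    show "continuous_on (-{0}) g"
      unfolding g_def by (intro continuous_on_compose2[OF holomorphic_on_imp_continuous_on[OF holo]]
          continuous_intros) auto
  qed (use P P1 b' in auto)
  have g_lim: "(g \<longlongrightarrow> 0) (at 0)"
  proof (rule Lim_null_comparison)
    \<comment> \<open>One more use of \<open>g_shift\<close>, at v = u / P: its factor v turns
      boundedness of g into linear decay.\<close>
    define D where "D = norm b' * (B' + norm K) / norm P"
    have "norm (g u) \<le> D * norm u" if u: "u \<noteq> 0" "norm u < norm P" for u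
    proof -
      define v where "v = u / P"
      have u': "u = P * v" and v: "v \<noteq> 0" "norm v \<le> 1"
        using u P by (auto simp: v_def norm_divide field_simps)
      have "norm (g v - K) \<le> B' + norm K"
        using B'[OF v] norm_triangle_ineq4[of "g v" K] by linarith
      then have "norm (b' * v * (g v - K)) \<le> norm b' * norm v * (B' + norm K)"
        by (simp add: norm_mult mult_left_mono)
      then show ?thesis using P v by (simp add: u' g_shift D_def norm_mult mult_ac)
    qed
    then show "eventually (\<lambda>u. norm (g u) \<le> D * norm u) (at 0)"
      using P by (auto simp: eventually_at intro!: exI[of _ "norm P"])
    show "((\<lambda>u. D * norm u) \<longlongrightarrow> 0) (at (0::complex))"
      by (auto intro!: tendsto_eq_intros)
  qed
  obtain F where F: "F holomorphic_on UNIV" "\<And>z. z \<noteq> 0 \<Longrightarrow> F z = f z"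
  proof -
    have "\<exists>B. eventually (\<lambda>z. norm (f z) \<le> B) (at 0)"
      by (rule exI[of _ B]) (use B in \<open>auto simp: eventually_at intro!: exI[of _ 1]\<close>)
    then have "\<exists>F. F holomorphic_on UNIV \<and> (\<forall>z\<in>UNIV - {0}. F z = f z)"
      using holo by (subst holomorphic_on_extend_bounded) (auto simp: Compl_eq_Diff_UNIV)
    then show ?thesis using that by auto
  qed
  have "(F \<longlongrightarrow> 0) at_infinity"
  proof -
    have "((F \<circ> inverse) \<longlongrightarrow> 0) (at 0)"
      by (rule Lim_transform_eventually[OF g_lim])
        (use F(2) in \<open>auto simp: eventually_at g_def inverse_eq_divide intro!: exI[of _ 1]\<close>)
    then show ?thesis by (simp add: lim_at_infinity_0)
  qed
  then show "f y = 0" if "y \<noteq> 0"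
    using Liouville_weak_0[OF F(1)] F(2)[OF that] by auto
qed

text \<open>Only the punctured germ counts: at a pole of its summands a function has an arbitrary
  value, because division by zero yields 0.\<close>

definition removable_at :: "(complex \<Rightarrow> complex) \<Rightarrow> complex \<Rightarrow> bool" where
  "removable_at f z \<longleftrightarrow> (\<exists>g. g analytic_on {z} \<and> (\<forall>\<^sub>F w in at z. f w = g w))"

lemma removable_at_analytic: "f analytic_on {z} \<Longrightarrow> removable_at f z"
  unfolding removable_at_def by auto

lemma removable_at_imp_tendsto_Lim:
  assumes "removable_at f z"
  shows "(f \<longlongrightarrow> Lim (at z) f) (at z)"
proof -
  obtain g where g: "g analytic_on {z}" "\<forall>\<^sub>F w in at z. f w = g w"
    using assms by (auto simp: removable_at_def)
  have "(g \<longlongrightarrow> g z) (at z)"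
    using g(1) by (simp add: analytic_at_imp_isCont isContD)
  then have "(f \<longlongrightarrow> g z) (at z)"
    by (rule Lim_transform_eventually) (use g(2) in \<open>simp add: eq_commute\<close>)
  then show ?thesis by (simp add: tendsto_Lim)
qed

text \<open>The local extensions glue without any choice: near z each one coincides with the
  function w to \<open>Lim (at w) f\<close>, which is defined globally.\<close>

lemma removable_at_imp_Lim_analytic:
  assumes "removable_at f z"
  shows "(\<lambda>z. Lim (at z) f) analytic_on {z}"
proof -
  obtain g where g: "g analytic_on {z}" "\<forall>\<^sub>F w in at z. f w = g w"
    using assms by (auto simp: removable_at_def)
  obtain r where r: "r > 0" "g holomorphic_on ball z r" "\<And>w. w \<in> ball z r - {z} \<Longrightarrow> f w = g w"
  proof -
    obtain r1 where r1: "r1 > 0" "g holomorphic_on ball z r1"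
      using g(1) by (auto simp: analytic_on_def)
    obtain r2 where r2: "r2 > 0" "\<And>w. w \<noteq> z \<Longrightarrow> dist w z < r2 \<Longrightarrow> f w = g w"
      using g(2) by (auto simp: eventually_at)
    show ?thesis
      by (rule that[of "min r1 r2"])
        (use r1 r2 in \<open>auto simp: dist_commute intro: holomorphic_on_subset\<close>)
  qed
  have "Lim (at w) f = g w" if w: "w \<in> ball z r" for w
  proof -
    have "isCont g w"
      using w r(2) holomorphic_on_imp_continuous_on continuous_on_eq_continuous_at by blast
    moreover have "\<forall>\<^sub>F x in at w. f x = g x"
      using eventually_at_in_open[OF open_ball w] eventually_neq_at_within[of z w]
      by eventually_elim (use r(3) in auto)
    ultimately have "(f \<longlongrightarrow> g w) (at w)"
      using tendsto_cong isContD by blast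
    then show ?thesis by (simp add: tendsto_Lim)
  qed
  then have "(\<lambda>w. Lim (at w) f) holomorphic_on ball z r"
    by (rule holomorphic_transform[OF r(2) sym])
  then show ?thesis
    using r(1) by (auto simp: analytic_on_def)
qed

text \<open>Here g gathers the numerators of all terms singular at a = 1/s, so
  \<open>g a = 0\<close> expresses that their residues cancel.\<close>

lemma removable_at_simple_pole:
  assumes g: "g analytic_on {a}" "g a = 0" and h: "h analytic_on {a}" and s: "s * a = 1"
    and f: "\<forall>\<^sub>F y in at a. f y = g y / (1 - s * y) + h y"
  shows "removable_at f a"
proof -
  define q where "q y = (if y = a then deriv g a else g y / (y - a) - g a / (y - a))" for y
  have q: "q analytic_on {a}"
    unfolding q_def using g(1) by (rule pole_theorem_analytic) (auto intro!: exI[of _ 1])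
  have "s \<noteq> 0" using s by auto
  have eq: "1 - s * y = - s * (y - a)" for y
    using s by (simp add: algebra_simps)
  have "\<forall>\<^sub>F y in at a. f y = - q y / s + h y"
    using f eventually_neq_at_within[of a a]
  proof eventually_elim
    case (elim y)
    have "g y / (1 - s * y) = - q y / s"
      using elim(2) \<open>s \<noteq> 0\<close> g(2) unfolding eq by (simp add: q_def)
    then show ?case using elim(1) by simp
  qed
  moreover have "(\<lambda>y. - q y / s + h y) analytic_on {a}"
    using q h \<open>s \<noteq> 0\<close> by (intro analytic_intros) auto
  ultimately show ?thesis unfolding removable_at_def by blast
qed

text \<open>The equation can be read in both directions, since b z is nonzero near y. Singularities
  therefore need checking only on one period of multiplication by P.\<close>

lemma removable_at_scale_iff:
  assumes P: "P \<noteq> 0" and b: "b \<noteq> 0" and y: "y \<noteq> 0"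
    and shift: "\<forall>\<^sub>F z in at y. f (P * z) = b * z * f z + K"
  shows "removable_at f (P * y) \<longleftrightarrow> removable_at f y"
proof
  have flim: "filterlim (\<lambda>z. P * z) (at (P * y)) (at y)"
    by (rule filterlim_atI)
      (use P in \<open>auto intro!: tendsto_intros simp: eventually_neq_at_within\<close>)
  have flim': "filterlim (\<lambda>z. z / P) (at y) (at (P * y))"
    by (rule filterlim_atI)
      (use P in \<open>auto intro!: tendsto_eq_intros eventually_mono[OF eventually_neq_at_within[of "P * y"]] simp: field_simps\<close>)
  {
    assume "removable_at f (P * y)"
    then obtain g where g: "g analytic_on {P * y}" "\<forall>\<^sub>F w in at (P * y). f w = g w"
      by (auto simp: removable_at_def)
    have "\<forall>\<^sub>F z in at y. f (P * z) = g (P * z)"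
      using g(2) by (rule eventually_compose_filterlim[OF _ flim])
    then have "\<forall>\<^sub>F z in at y. f z = (g (P * z) - K) / (b * z)"
      using shift eventually_neq_at_within[of 0 y]
    proof eventually_elim
      case (elim z)
      then have "b * z * f z = g (P * z) - K" by (simp add: algebra_simps)
      then show ?case using elim(3) b by (simp add: field_simps)
    qed
    moreover have "(\<lambda>z. (g (P * z) - K) / (b * z)) analytic_on {y}"
      using b y by (intro analytic_intros analytic_on_compose_gen[OF _ g(1), unfolded o_def]) auto
    ultimately show "removable_at f y" unfolding removable_at_def by blast
  }
  {
    assume "removable_at f y"
    then obtain g where g: "g analytic_on {y}" "\<forall>\<^sub>F w in at y. f w = g w"
      by (auto simp: removable_at_def)
    have "\<forall>\<^sub>F z in at y. f (P * z) = b * z * g z + K"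
      using g(2) shift by eventually_elim auto
    then have "\<forall>\<^sub>F w in at (P * y). f (P * (w / P)) = b * (w / P) * g (w / P) + K"
      by (rule eventually_compose_filterlim[OF _ flim'])
    then have "\<forall>\<^sub>F w in at (P * y). f w = b * (w / P) * g (w / P) + K"
      using P by simp
    moreover have "(\<lambda>w. b * (w / P) * g (w / P) + K) analytic_on {P * y}"
      using P by (intro analytic_intros analytic_on_compose_gen[OF _ g(1), unfolded o_def]) auto
    ultimately show "removable_at f (P * y)" unfolding removable_at_def by blast
  }
qed

text \<open>The limit function of f is holomorphic on the punctured plane and inherits the equation,
  so it vanishes; continuity at y brings this back to the actual value \<open>f y\<close>.\<close>

lemma removable_shift_equation_imp_zero:
  assumes rem: "\<And>y. y \<noteq> 0 \<Longrightarrow> removable_at f y" and P: "P \<noteq> 0" "norm P < norm b" "norm b < 1"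
    and shift: "\<And>y. y \<noteq> 0 \<Longrightarrow> \<forall>\<^sub>F z in at y. f (P * z) = b * z * f z + K"
    and y: "y \<noteq> 0" "isCont f y"
  shows "f y = 0"
proof -
  define F where "F z = Lim (at z) f" for z
  have F_lim: "(f \<longlongrightarrow> F z) (at z)" if "z \<noteq> 0" for z
    unfolding F_def by (rule removable_at_imp_tendsto_Lim[OF rem[OF that]])
  have "F analytic_on -{0}"
    unfolding analytic_on_analytic_at[of _ "-{0}"] F_def
    using rem removable_at_imp_Lim_analytic by auto
  then have holo: "F holomorphic_on -{0}" by (rule analytic_imp_holomorphic)
  have "F (P * z) = b * z * F z + K" if z: "z \<noteq> 0" for z
  proof -
    have "filterlim (\<lambda>w. P * w) (at (P * z)) (at z)"
      by (rule filterlim_atI)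
        (use P in \<open>auto intro!: tendsto_intros simp: eventually_neq_at_within\<close>)
    then have "((\<lambda>w. f (P * w)) \<longlongrightarrow> F (P * z)) (at z)"
      using F_lim[of "P * z"] z P by (auto intro: filterlim_compose)
    then have "((\<lambda>w. b * w * f w + K) \<longlongrightarrow> F (P * z)) (at z)"
      using shift[OF z] by (rule Lim_transform_eventually)
    moreover have "((\<lambda>w. b * w * f w + K) \<longlongrightarrow> b * z * F z + K) (at z)"
      by (intro tendsto_intros F_lim z)
    ultimately show ?thesis
      by (rule tendsto_unique[OF trivial_limit_at])
  qed
  then have "F y = 0" by (rule shift_equation_imp_zero[OF holo P _ y(1)])
  moreover have "F y = f y"
    unfolding F_def using y(2) by (intro tendsto_Lim isContD) auto
  ultimately show ?thesis by simp
qed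

section \<open>Partial fraction series\<close>

text \<open>The finiteness assumption lets the a n accumulate only at 0 and infinity. So only
  finitely many terms can have a pole near z, and the others are dominated by 2 |w n|.\<close>

lemma partial_fractions_analytic:
  fixes a w :: "'i \<Rightarrow> complex"
  assumes summ: "(\<lambda>n. norm (w n)) summable_on S" and fin: "\<And>r. r > 0 \<Longrightarrow> finite {n \<in> S. 1 / r \<le> norm (a n) \<and> norm (a n) \<le> r}"
    and z: "z \<noteq> 0" "\<And>n. n \<in> S \<Longrightarrow> z * a n \<noteq> 1"
  shows "(\<lambda>y. \<Sum>\<^sub>\<infinity>n\<in>S. w n / (1 - y * a n)) analytic_on {z}"
    and partial_fractions_summable: "(\<lambda>n. w n / (1 - z * a n)) summable_on S"
proof -
  \<comment> \<open>On the disc |z|/2 <= |y| <= 3|z|/2. Then 3|z| <= R gives |y a n| <= 1/2 when |a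
    n| < 1/R, and 4/|z| <= R gives |y a n| >= 2 when |a n| > R; either way |1 - y a n| >=
    1/2.\<close>
  define r R where "r = norm z / 2" and "R = max (3 * norm z) (4 / norm z)"
  define F where "F = {n \<in> S. 1 / R \<le> norm (a n) \<and> norm (a n) \<le> R}"
  have r: "r > 0" and R: "R > 0" using z by (auto simp: r_def R_def less_max_iff_disj)
  have "finite F" unfolding F_def by (rule fin[OF R])
  have bound: "norm (w n / (1 - y * a n)) \<le> 2 * norm (w n)" and nz: "1 - y * a n \<noteq> 0"
    if n: "n \<in> S - F" and y: "y \<in> cball z r" for n y
  proof -
    have y2: "norm y \<le> 3 / 2 * norm z" "norm z / 2 \<le> norm y"
      using y norm_triangle_ineq2[of y z] norm_triangle_ineq2[of z y]
      by (auto simp: r_def dist_norm norm_minus_commute)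
    have "1 / 2 \<le> norm (1 - y * a n)"
    proof (cases "norm (a n) < 1 / R")
      case True
      have "norm (y * a n) \<le> (3 / 2 * norm z) * (1 / R)"
        unfolding norm_mult using True y2 by (intro mult_mono) auto
      also have "\<dots> \<le> 1 / 2"
      proof -
        have "3 * norm z \<le> R" by (simp add: R_def)
        then show ?thesis using R by (simp add: field_simps)
      qed
      finally show ?thesis using norm_triangle_ineq2[of 1 "y * a n"] by simp
    next
      case False
      then have "R < norm (a n)" using n by (auto simp: F_def)
      have "2 \<le> (norm z / 2) * R"
      proof -
        have "4 / norm z \<le> R" by (simp add: R_def)
        then show ?thesis using z by (simp add: field_simps)
      qed
      also have "\<dots> \<le> norm (y * a n)"
        unfolding norm_mult using y2 \<open>R < norm (a n)\<close> R by (intro mult_mono) auto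
      finally show ?thesis using norm_triangle_ineq3[of "y * a n" 1] by (simp add: norm_minus_commute)
    qed
    moreover from this show "1 - y * a n \<noteq> 0" by auto
    ultimately show "norm (w n / (1 - y * a n)) \<le> 2 * norm (w n)"
      unfolding norm_divide using mult_left_mono[of "1/2" "norm (1 - y * a n)" "2 * norm (w n)"]
      by (simp add: divide_le_eq)
  qed
  have M: "(\<lambda>n. 2 * norm (w n)) summable_on (S - F)"
    by (intro summable_on_cmult_right summable_on_subset_banach[OF summ]) auto
  have tail_summable: "(\<lambda>n. w n / (1 - y * a n)) summable_on (S - F)" if "y \<in> cball z r" for y
  proof (rule abs_summable_summable, rule summable_on_comparison_test[OF M])
    show "norm (w n / (1 - y * a n)) \<le> 2 * norm (w n)" if "n \<in> S - F" for n
      using that \<open>y \<in> cball z r\<close> by (rule bound)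
  qed auto
  have "uniform_limit (cball z r) (\<lambda>X y. \<Sum>n\<in>X. w n / (1 - y * a n))
      (\<lambda>y. \<Sum>\<^sub>\<infinity>n\<in>S - F. w n / (1 - y * a n)) (finite_subsets_at_top (S - F))"
    by (rule Weierstrass_m_test_general[OF _ M]) (rule bound)
  moreover have "\<forall>\<^sub>F X in finite_subsets_at_top (S - F).
      continuous_on (cball z r) (\<lambda>y. \<Sum>n\<in>X. w n / (1 - y * a n)) \<and>
      (\<lambda>y. \<Sum>n\<in>X. w n / (1 - y * a n)) holomorphic_on ball z r"
  proof (rule eventually_finite_subsets_at_top_weakI)
    fix X assume X: "finite X" "X \<subseteq> S - F"
    have "1 - y * a n \<noteq> 0" if "n \<in> X" "y \<in> cball z r" for n y
      using nz X that by blast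
    then have "(\<lambda>y. \<Sum>n\<in>X. w n / (1 - y * a n)) holomorphic_on cball z r"
      by (intro holomorphic_intros) auto
    then show "continuous_on (cball z r) (\<lambda>y. \<Sum>n\<in>X. w n / (1 - y * a n)) \<and>
      (\<lambda>y. \<Sum>n\<in>X. w n / (1 - y * a n)) holomorphic_on ball z r"
      by (meson ball_subset_cball holomorphic_on_imp_continuous_on holomorphic_on_subset)
  qed
  ultimately have "(\<lambda>y. \<Sum>\<^sub>\<infinity>n\<in>S - F. w n / (1 - y * a n)) holomorphic_on ball z r"
    by - (erule (1) holomorphic_uniform_limit, rule finite_subsets_at_top_neq_bot)
  then have "(\<lambda>y. \<Sum>\<^sub>\<infinity>n\<in>S - F. w n / (1 - y * a n)) analytic_on {z}"
    using r by (auto simp: analytic_on_def)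
  moreover have "1 - z * a n \<noteq> 0" if "n \<in> F" for n
    using z(2)[of n] that by (auto simp: F_def)
  then have "(\<lambda>y. \<Sum>n\<in>F. w n / (1 - y * a n)) analytic_on {z}"
    by (intro analytic_intros) auto
  ultimately have "(\<lambda>y. (\<Sum>n\<in>F. w n / (1 - y * a n)) + (\<Sum>\<^sub>\<infinity>n\<in>S - F. w n / (1 - y * a n))) analytic_on {z}"
    by (simp only: analytic_on_add)
  moreover have split: "(\<Sum>n\<in>F. w n / (1 - y * a n)) + (\<Sum>\<^sub>\<infinity>n\<in>S - F. w n / (1 - y * a n)) = (\<Sum>\<^sub>\<infinity>n\<in>S. w n / (1 - y * a n))"
    and all_summable: "(\<lambda>n. w n / (1 - y * a n)) summable_on S"
    if "y \<in> cball z r" for y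
  proof -
    have S: "S = F \<union> (S - F)" by (auto simp: F_def)
    show "(\<Sum>n\<in>F. w n / (1 - y * a n)) + (\<Sum>\<^sub>\<infinity>n\<in>S - F. w n / (1 - y * a n)) = (\<Sum>\<^sub>\<infinity>n\<in>S. w n / (1 - y * a n))"
      by (subst (2) S, subst infsum_Un_disjoint)
        (use \<open>finite F\<close> tail_summable that in auto)
    show "(\<lambda>n. w n / (1 - y * a n)) summable_on S"
      by (subst S, rule summable_on_Un_disjoint)
        (use \<open>finite F\<close> tail_summable that in auto)
  qed
  moreover have "\<forall>\<^sub>F y in nhds z. y \<in> cball z r"
    using eventually_nhds_in_open[OF open_ball, of z z r] r by (auto elim: eventually_mono)
  ultimately show "(\<lambda>y. \<Sum>\<^sub>\<infinity>n\<in>S. w n / (1 - y * a n)) analytic_on {z}"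
    by (subst analytic_at_cong) (auto elim!: eventually_mono)
  show "(\<lambda>n. w n / (1 - z * a n)) summable_on S"
    using all_summable r by simp
qed

lemma finite_powi_between:
  fixes P c :: complex
  assumes "P \<noteq> 0" "norm P < 1" "c \<noteq> 0" "r > 0"
  shows "finite {n::int. 1 / r \<le> norm (c * P powi n) \<and> norm (c * P powi n) \<le> r}"
proof -
  define s where "s = norm P"
  have s: "0 < s" "s < 1" using assms by (auto simp: s_def)
  obtain N where N: "s ^ N < norm c / r"
    using real_arch_pow_inv[of "norm c / r" s] s assms by auto
  obtain M where M: "s ^ M < 1 / (r * norm c)"
    using real_arch_pow_inv[of "1 / (r * norm c)" s] s assms by auto
  have "{n. 1 / r \<le> norm (c * P powi n) \<and> norm (c * P powi n) \<le> r} \<subseteq> {- int N..int M}"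
  proof safe
    fix n assume n: "1 / r \<le> norm (c * P powi n)" "norm (c * P powi n) \<le> r"
    show "n \<in> {- int N..int M}"
    proof (rule ccontr)
      assume "n \<notin> {- int N..int M}"
      then consider "n < - int N" | "n > int M" by force
      then show False
      proof cases
        case 1
        then have "s powi (-n) \<le> s powi int N"
          using s by (intro power_int_decreasing) auto
        then have "s powi (-n) < norm c / r" using N by (simp add: power_int_of_nat)
        then show False using n(2) s assms
          by (simp add: norm_mult norm_power_int power_int_minus s_def[symmetric] field_simps)
      next
        case 2
        then have "s powi n \<le> s powi int M"
          using s by (intro power_int_decreasing) auto
        then have "s powi n < 1 / (r * norm c)" using M by (simp add: power_int_of_nat)
        then show False using n(1) s assms
          by (simp add: norm_mult norm_power_int s_def[symmetric] field_simps)
      qed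
    qed
  qed
  then show ?thesis by (rule finite_subset) auto
qed

lemma summable_on_int_if_nat:
  fixes f :: "int \<Rightarrow> 'a :: banach"
  assumes "(\<lambda>n::nat. f (int n)) summable_on UNIV" "(\<lambda>n::nat. f (- int n)) summable_on UNIV"
  shows "f summable_on UNIV"
proof -
  have "f summable_on range int"
    using assms(1) by (subst summable_on_reindex) (auto simp: o_def)
  moreover have "f summable_on range (\<lambda>n. - int n)"
    using assms(2) by (subst summable_on_reindex) (auto simp: o_def inj_on_def)
  then have "f summable_on (range (\<lambda>n. - int n) - range int)"
    by (rule summable_on_subset_banach) auto
  ultimately have "f summable_on (range int \<union> (range (\<lambda>n. - int n) - range int))"
    by (rule summable_on_Un_disjoint) auto
  moreover have "range int \<union> (range (\<lambda>n. - int n) - range int) = UNIV"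
    using int_cases2 by blast
  ultimately show ?thesis by simp
qed

lemma summable_on_quadratic_powi:
  fixes r :: real and b c :: int
  assumes r: "0 < r" "r < 1"
  shows "(\<lambda>n::int. (\<bar>real_of_int n\<bar> + 1) * r powi (3 * n\<^sup>2 + b * n + c)) summable_on UNIV"
proof -
  \<comment> \<open>From (2n + b)^2 >= 0 follows b n >= -n^2 - b^2, so 3n^2 leaves enough to cover
    |n|; the exponent c - b^2 is the remaining constant.\<close>
  define K where "K = r powi (c - b\<^sup>2)"
  have nat: "(\<lambda>n::nat. (real n + 1) * r ^ n * K) summable_on UNIV"
  proof (rule summable_on_cmult_left, rule summable_nonneg_imp_summable_on)
    show "summable (\<lambda>n. (real n + 1) * r ^ n)"
      using r geometric_deriv_sums[of r] by (simp add: sums_iff add.commute)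
  qed (use r in auto)
  have bound: "(\<bar>real_of_int n\<bar> + 1) * r powi (3 * n\<^sup>2 + b * n + c) \<le> (\<bar>real_of_int n\<bar> + 1) * (r powi \<bar>n\<bar> * K)" for n
  proof -
    have "\<bar>n\<bar> + (c - b\<^sup>2) \<le> 3 * n\<^sup>2 + b * n + c"
    proof -
      have "\<bar>n\<bar> * 1 \<le> \<bar>n\<bar> * \<bar>n\<bar>"
        by (cases "n = 0") (simp, intro mult_left_mono, auto)
      then have "\<bar>n\<bar> \<le> n\<^sup>2" by (simp add: power2_eq_square)
      moreover have "0 \<le> (2 * n + b)\<^sup>2 " "0 \<le> b\<^sup>2" "0 \<le> n\<^sup>2" by auto
      moreover have "(2 * n + b)\<^sup>2 = 4 * n\<^sup>2 + 4 * (b * n) + b\<^sup>2"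
        by (simp add: power2_eq_square algebra_simps)
      ultimately show ?thesis by linarith
    qed
    then have "r powi (3 * n\<^sup>2 + b * n + c) \<le> r powi (\<bar>n\<bar> + (c - b\<^sup>2))"
      using r by (intro power_int_decreasing) auto
    also have "\<dots> = r powi \<bar>n\<bar> * K"
      using r by (simp add: K_def power_int_add)
    finally show ?thesis by (intro mult_left_mono) auto
  qed
  have "(\<lambda>n::int. (\<bar>real_of_int n\<bar> + 1) * (r powi \<bar>n\<bar> * K)) summable_on UNIV"
    by (rule summable_on_int_if_nat) (use nat in \<open>simp_all add: power_int_of_nat mult_ac\<close>)
  then show ?thesis
    by (rule summable_on_comparison_test) (use r bound in auto)
qed

section \<open>Theta functions and their logarithmic derivatives\<close>

lemma convergent_prod_qpoch_inf1:
  fixes P :: complex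
  assumes "norm P < 1"
  shows "convergent_prod (\<lambda>k. 1 - a * P ^ k)"
  by (rule abs_convergent_prod_imp_convergent_prod)
    (use assms in \<open>auto simp: abs_convergent_prod_conv_summable norm_mult norm_power
       intro!: summable_mult summable_geometric\<close>)

lemma qpoch_inf1_rec:
  assumes "norm P < 1"
  shows "qpoch_inf1 a P = (1 - a) * qpoch_inf1 (P * a) P"
proof -
  have "(\<lambda>k. 1 - a * P ^ k) has_prod ((\<Prod>k<1. 1 - a * P ^ k) * (\<Prod>k. 1 - a * P ^ (k + 1)))"
    by (intro has_prod_ignore_initial_segment' convergent_prod_qpoch_inf1 assms)
  then show ?thesis
    unfolding qpoch_inf1_def by (subst has_prod_unique[symmetric]) (auto simp: mult_ac)
qed

lemma qpoch_inf1_nonzero: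
  assumes "norm P < 1" "\<And>k::nat. a * P ^ k \<noteq> 1"
  shows "qpoch_inf1 a P \<noteq> 0"
  unfolding qpoch_inf1_def
  by (rule prodinf_nonzero[OF convergent_prod_qpoch_inf1[OF assms(1)]]) (metis assms(2) right_minus_eq)

lemma qpoch_inf1_holomorphic:
  assumes "norm P < 1"
  shows "(\<lambda>a. qpoch_inf1 a P) holomorphic_on UNIV"
proof -
  have "(\<lambda>a. qpoch_inf1 a P) holomorphic_on ball 0 R" for R
  proof -
    have "uniformly_convergent_on (cball 0 R) (\<lambda>N a. \<Sum>k<N. norm ((1 - a * P ^ k) - 1))"
    proof (rule Weierstrass_m_test')
      show "summable (\<lambda>k. R * norm P ^ k)"
        using assms by (intro summable_mult summable_geometric) auto
      show "norm (norm ((1 - a * P ^ k) - 1)) \<le> R * norm P ^ k" if "a \<in> cball 0 R" for a k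
        using that by (auto simp: norm_mult norm_power intro!: mult_right_mono)
    qed
    then have "uniformly_convergent_on (cball 0 R) (\<lambda>N a. \<Prod>k<N. 1 - a * P ^ k)"
      by (intro uniformly_convergent_on_prod') (auto intro!: continuous_intros)
    then obtain l where l: "uniform_limit (cball 0 R) (\<lambda>N a. \<Prod>k<N. 1 - a * P ^ k) l sequentially"
      by (auto simp: uniformly_convergent_on_def)
    have "l holomorphic_on ball 0 R"
      using _ l trivial_limit_sequentially
      by (rule holomorphic_uniform_limit)
        (auto intro!: always_eventually continuous_intros holomorphic_intros)
    moreover have "l a = qpoch_inf1 a P" if "a \<in> ball 0 R" for a
    proof -
      have "(\<lambda>N. \<Prod>k<N. 1 - a * P ^ k) \<longlonglongrightarrow> l a"
        using l that by (auto intro: tendsto_uniform_limitI)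
      moreover have "(\<lambda>N. \<Prod>k<N. 1 - a * P ^ k) \<longlonglongrightarrow> qpoch_inf1 a P"
        unfolding qpoch_inf1_def using convergent_prod_qpoch_inf1[OF assms]
        by (intro has_prod_imp_tendsto' convergent_prod_has_prod)
      ultimately show ?thesis by (rule LIMSEQ_unique)
    qed
    ultimately show ?thesis by (rule holomorphic_transform)
  qed
  then have "(\<lambda>a. qpoch_inf1 a P) analytic_on {a}" for a
    unfolding analytic_at by (intro exI[of _ "ball 0 (norm a + 1)"]) auto
  then show ?thesis by (metis analytic_imp_holomorphic analytic_on_analytic_at)
qed

lemma qpoch_inf1_analytic [analytic_intros]:
  assumes "f analytic_on A" "norm P < 1"
  shows "(\<lambda>z. qpoch_inf1 (f z) P) analytic_on A"
proof -
  have "(\<lambda>a. qpoch_inf1 a P) analytic_on UNIV"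
    using qpoch_inf1_holomorphic[OF assms(2)] by (simp add: analytic_on_open)
  then show ?thesis
    using analytic_on_compose_gen[OF assms(1), of "\<lambda>a. qpoch_inf1 a P" UNIV] by (simp add: o_def)
qed

text \<open>The one-argument bracket [z; P], a Jacobi theta function up to the factor (P; P); its
  zeros are the integer powers of P.\<close>

definition jtheta :: "complex \<Rightarrow> complex \<Rightarrow> complex" where
  "jtheta P z = qpoch_inf1 z P * qpoch_inf1 (P / z) P"

lemma qbracket_inf_eq_jtheta: "qbracket_inf as P = (\<Prod>a\<leftarrow>as. jtheta P a)"
  by (induction as) (auto simp: qbracket_inf_def qpoch_inf_def jtheta_def)

lemma jtheta_analytic [analytic_intros]:
  assumes "f analytic_on A" "norm P < 1" "\<And>z. z \<in> A \<Longrightarrow> f z \<noteq> 0"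
  shows "(\<lambda>z. jtheta P (f z)) analytic_on A"
  unfolding jtheta_def using assms by (intro analytic_intros) auto

text \<open>One product loses the factor 1 - z and the other gains 1 - 1/z, whose ratio is
  -1/z.\<close>

lemma jtheta_shift:
  assumes "P \<noteq> 0" "norm P < 1" "z \<noteq> 0"
  shows "jtheta P (P * z) = - jtheta P z / z"
proof -
  have *: "qpoch_inf1 z P = (1 - z) * qpoch_inf1 (P * z) P"
      "qpoch_inf1 (1 / z) P = (1 - 1 / z) * qpoch_inf1 (P / z) P"
    using qpoch_inf1_rec[OF assms(2), of z] qpoch_inf1_rec[OF assms(2), of "1 / z"] by auto
  have "P / (P * z) = 1 / z" using assms by simp
  then show ?thesis
    unfolding jtheta_def using assms(3) by (simp only: *) (simp add: divide_simps, simp add: algebra_simps)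
qed

lemma jtheta_inverse:
  assumes "P \<noteq> 0" "norm P < 1" "z \<noteq> 0"
  shows "jtheta P (1 / z) = - jtheta P z / z"
proof -
  have *: "qpoch_inf1 z P = (1 - z) * qpoch_inf1 (P * z) P"
      "qpoch_inf1 (1 / z) P = (1 - 1 / z) * qpoch_inf1 (P / z) P"
    using qpoch_inf1_rec[OF assms(2), of z] qpoch_inf1_rec[OF assms(2), of "1 / z"] by auto
  have "P / (1 / z) = P * z" using assms by simp
  then show ?thesis
    unfolding jtheta_def using assms(3) by (simp only: *) (simp add: divide_simps, simp add: algebra_simps)
qed

lemma powi_ne_1_cases:
  fixes P z :: complex
  assumes "P \<noteq> 0" "z \<noteq> 0" "\<And>n::int. z * P powi n \<noteq> 1"
  shows "z * P ^ m \<noteq> 1" "1 / z * P ^ m \<noteq> 1" "P / z * P ^ m \<noteq> 1"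
proof -
  show "z * P ^ m \<noteq> 1"
    using assms(3)[of "int m"] by (simp add: power_int_of_nat)
  show "1 / z * P ^ m \<noteq> 1"
    using assms(1,2) assms(3)[of "- int m"]
    by (auto simp: power_int_minus power_int_of_nat divide_simps)
  \<comment> \<open>The product of P/z starts one power later than that of 1/z, so the exponent is
    -(m + 1).\<close>
  have "P powi (- int (Suc m)) = 1 / (P * P ^ m)"
    unfolding power_int_minus power_int_of_nat by (simp add: inverse_eq_divide)
  then have "z * (1 / (P * P ^ m)) \<noteq> 1"
    using assms(3)[of "- int (Suc m)"] by (simp only:) simp
  then show "P / z * P ^ m \<noteq> 1"
    using assms(1,2) by (auto simp: divide_simps)
qed

lemma jtheta_nonzero:
  assumes "P \<noteq> 0" "norm P < 1" "z \<noteq> 0" "\<And>n::int. z * P powi n \<noteq> 1"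
  shows "jtheta P z \<noteq> 0"
  unfolding jtheta_def
  using qpoch_inf1_nonzero[OF assms(2) powi_ne_1_cases(1)[OF assms(1,3,4)]]
    qpoch_inf1_nonzero[OF assms(2) powi_ne_1_cases(3)[OF assms(1,3,4)]]
  by (metis mult_eq_0_iff)

text \<open>Equals -z d/dz log (z; P). With z pulled out, the weights P^m are independent of z, the
  shape required by \<open>partial_fractions_analytic\<close>.\<close>

definition lambert :: "complex \<Rightarrow> complex \<Rightarrow> complex" where
  "lambert P z = z * (\<Sum>\<^sub>\<infinity>m::nat. P ^ m / (1 - z * P ^ m))"

lemma lambert_analytic_at:
  assumes "P \<noteq> 0" "norm P < 1" "z \<noteq> 0" "\<And>m::nat. z * P ^ m \<noteq> 1"
  shows "lambert P analytic_on {z}"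
    and lambert_sums: "(\<lambda>m. z * P ^ m / (1 - z * P ^ m)) sums lambert P z"
proof -
  have summ: "(\<lambda>m. norm (P ^ m)) summable_on UNIV"
    using assms by (intro norm_summable_imp_summable_on) (auto simp: norm_power intro!: summable_geometric)
  have fin: "finite {m \<in> UNIV. 1 / r \<le> norm (P ^ m) \<and> norm (P ^ m) \<le> r}" if "r > 0" for r
  proof -
    have "finite (int -` {n::int. 1 / r \<le> norm (1 * P powi n) \<and> norm (1 * P powi n) \<le> r})"
      by (intro finite_vimageI finite_powi_between) (use assms that in auto)
    then show ?thesis by (simp add: vimage_def power_int_of_nat)
  qed
  have "(\<lambda>m. P ^ m / (1 - z * P ^ m)) summable_on UNIV"
    using summ fin assms(3,4) by (rule partial_fractions_summable)
  then have "(\<lambda>m. P ^ m / (1 - z * P ^ m)) sums (\<Sum>\<^sub>\<infinity>m. P ^ m / (1 - z * P ^ m))"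
    by (intro has_sum_imp_sums has_sum_infsum)
  from sums_mult[OF this, of z]
  show "(\<lambda>m. z * P ^ m / (1 - z * P ^ m)) sums lambert P z"
    by (simp add: lambert_def)
  have "(\<lambda>y. \<Sum>\<^sub>\<infinity>m. P ^ m / (1 - y * P ^ m)) analytic_on {z}"
    using summ fin assms(3,4) by (rule partial_fractions_analytic)
  then show "lambert P analytic_on {z}"
    unfolding lambert_def by (intro analytic_intros)
qed

lemma lambert_analytic:
  assumes f: "f analytic_on {z}" and P: "P \<noteq> 0" "norm P < 1" "f z \<noteq> 0" "\<And>m::nat. f z * P ^ m \<noteq> 1"
  shows "(\<lambda>w. lambert P (f w)) analytic_on {z}"
  using analytic_on_compose_gen[OF f lambert_analytic_at(1)[OF P]] by (simp add: o_def)

lemma lambert_rec: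
  assumes P: "P \<noteq> 0" "norm P < 1" "z \<noteq> 0" "\<And>m::nat. z * P ^ m \<noteq> 1"
  shows "lambert P z = z / (1 - z) + lambert P (P * z)"
proof -
  have "(\<lambda>m. (P * z) * P ^ m / (1 - (P * z) * P ^ m)) sums lambert P (P * z)"
  proof (rule lambert_sums)
    show "P * z * P ^ m \<noteq> 1" for m
      using P(4)[of "Suc m"] by (simp add: mult_ac)
  qed (use P in auto)
  then have "(\<lambda>m. z * P ^ Suc m / (1 - z * P ^ Suc m)) sums lambert P (P * z)"
    by (simp add: mult_ac)
  then have "(\<lambda>m. z * P ^ m / (1 - z * P ^ m)) sums (lambert P (P * z) + z * P ^ 0 / (1 - z * P ^ 0))"
    by (rule sums_Suc)
  then show ?thesis
    using lambert_sums[OF P] by (simp add: sums_iff add.commute)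
qed

text \<open>This is -z d/dz log \<open>jtheta P z\<close>, given directly as a difference of Lambert
  series.\<close>

definition jtheta_log :: "complex \<Rightarrow> complex \<Rightarrow> complex" where
  "jtheta_log P z = lambert P z - lambert P (P / z)"

lemma jtheta_log_analytic:
  assumes f: "f analytic_on {z}" and P: "P \<noteq> 0" "norm P < 1" "f z \<noteq> 0" "\<And>n::int. f z * P powi n \<noteq> 1"
  shows "(\<lambda>w. jtheta_log P (f w)) analytic_on {z}"
  unfolding jtheta_log_def using P powi_ne_1_cases[OF P(1,3,4)] f
  by (intro analytic_intros lambert_analytic) auto

text \<open>The logarithmic counterpart of \<open>jtheta_shift\<close>: the factor 1/z there
  contributes the summand 1. Concretely, the two end terms of the Lambert series sum to -1.\<close>

lemma jtheta_log_shift: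
  assumes P: "P \<noteq> 0" "norm P < 1" "z \<noteq> 0" "\<And>n::int. z * P powi n \<noteq> 1"
  shows "jtheta_log P (P * z) = jtheta_log P z + 1"
proof -
  note nz = powi_ne_1_cases[OF P(1,3,4)]
  have "lambert P z = z / (1 - z) + lambert P (P * z)"
    using P nz by (intro lambert_rec) auto
  moreover have "lambert P (1 / z) = (1 / z) / (1 - 1 / z) + lambert P (P * (1 / z))"
    using P nz by (intro lambert_rec) auto
  moreover have "z \<noteq> 1" using nz(1)[of 0] by simp
  then have "z / (1 - z) + (1 / z) / (1 - 1 / z) = -1"
    using P(3) by (simp add: divide_simps) (simp add: algebra_simps)
  ultimately show ?thesis
    using P by (simp add: jtheta_log_def algebra_simps)
qed

lemma jtheta_log_inverse:
  assumes P: "P \<noteq> 0" "norm P < 1" "z \<noteq> 0" "\<And>n::int. z * P powi n \<noteq> 1"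
  shows "jtheta_log P (1 / z) = - jtheta_log P z - 1"
proof -
  note nz = powi_ne_1_cases[OF P(1,3,4)]
  have "lambert P z = z / (1 - z) + lambert P (P * z)"
    using P nz by (intro lambert_rec) auto
  moreover have "lambert P (1 / z) = (1 / z) / (1 - 1 / z) + lambert P (P * (1 / z))"
    using P nz by (intro lambert_rec) auto
  moreover have "z \<noteq> 1" using nz(1)[of 0] by simp
  then have "z / (1 - z) + (1 / z) / (1 - 1 / z) = -1"
    using P(3) by (simp add: divide_simps) (simp add: algebra_simps)
  ultimately show ?thesis
    using P by (simp add: jtheta_log_def algebra_simps)
qed

lemma jtheta_1: 
  assumes "norm P < 1"
  shows "jtheta P 1 = 0"
  using qpoch_inf1_rec[OF assms, of 1] by (simp add: jtheta_def)

text \<open>The cofactor of the simple zero at z = 1, with value (P; P)^2 there; it supplies the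
  residues of quotients of thetas.\<close>

definition jtheta_regular :: "complex \<Rightarrow> complex \<Rightarrow> complex" where
  "jtheta_regular P z = qpoch_inf1 (P * z) P * qpoch_inf1 (P / z) P"

lemma jtheta_split:
  assumes "norm P < 1"
  shows "jtheta P z = (1 - z) * jtheta_regular P z"
  using qpoch_inf1_rec[OF assms, of z] by (simp add: jtheta_def jtheta_regular_def)

lemma jtheta_regular_analytic [analytic_intros]:
  assumes "f analytic_on A" "norm P < 1" "\<And>z. z \<in> A \<Longrightarrow> f z \<noteq> 0"
  shows "(\<lambda>z. jtheta_regular P (f z)) analytic_on A"
  unfolding jtheta_regular_def using assms by (intro analytic_intros) auto

lemma nome_power_ne_1:
  fixes P :: complex
  assumes "norm P < 1"
  shows "P * P ^ m \<noteq> 1"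
proof
  assume "P * P ^ m = 1"
  then have "norm P ^ Suc m = 1" by (metis norm_one norm_power power_Suc)
  moreover have "norm P ^ Suc m \<le> norm P"
    using assms by (simp add: mult_left_le power_le_one)
  ultimately show False using assms by linarith
qed

text \<open>The part analytic at z = 1, left after removing the polar term z / (1 - z).\<close>

definition jtheta_log_regular :: "complex \<Rightarrow> complex \<Rightarrow> complex" where
  "jtheta_log_regular P z = lambert P (P * z) - lambert P (P / z)"

lemma jtheta_log_split:
  assumes "P \<noteq> 0" "norm P < 1" "z \<noteq> 0" "\<And>m::nat. z * P ^ m \<noteq> 1"
  shows "jtheta_log P z = z / (1 - z) + jtheta_log_regular P z"
  using lambert_rec[OF assms] by (simp add: jtheta_log_def jtheta_log_regular_def)

lemma jtheta_log_regular_analytic: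
  assumes "f analytic_on {z}" "f z = 1" "P \<noteq> 0" "norm P < 1"
  shows "(\<lambda>w. jtheta_log_regular P (f w)) analytic_on {z}"
  unfolding jtheta_log_regular_def using assms nome_power_ne_1[OF assms(4)]
  by (intro analytic_intros lambert_analytic) auto

text \<open>The factors are sorted by exponent mod 3, through partial products of length 3N. This
  carries products in p^2 over to the nome p^6.\<close>

lemma qpoch_inf1_trisect:
  assumes "norm r < 1"
  shows "qpoch_inf1 a r = qpoch_inf1 a (r ^ 3) * qpoch_inf1 (a * r) (r ^ 3) * qpoch_inf1 (a * r\<^sup>2) (r ^ 3)"
proof -
  have r3: "norm (r ^ 3) < 1"
    using assms by (simp add: norm_power power_less_one_iff)
  have lim: "(\<lambda>N. \<Prod>k<N. 1 - b * P ^ k) \<longlonglongrightarrow> qpoch_inf1 b P" if "norm P < 1" for b P :: complex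
    unfolding qpoch_inf1_def
    by (intro has_prod_imp_tendsto' convergent_prod_has_prod convergent_prod_qpoch_inf1 that)
  have "(\<lambda>N. \<Prod>k<3 * N. 1 - a * r ^ k) \<longlonglongrightarrow> qpoch_inf1 a r"
    using filterlim_compose[OF lim[OF assms], of "\<lambda>N. 3 * N"]
    by (simp add: mult_nat_left_at_top)
  moreover have "(\<Prod>k<3 * N. 1 - a * r ^ k) =
    (\<Prod>k<N. 1 - a * (r ^ 3) ^ k) * (\<Prod>k<N. 1 - a * r * (r ^ 3) ^ k) * (\<Prod>k<N. 1 - a * r\<^sup>2 * (r ^ 3) ^ k)" for N
  proof (induction N)
    case (Suc N)
    have "3 * Suc N = Suc (Suc (Suc (3 * N)))" by simp
    then show ?case
      by (simp only: prod.lessThan_Suc Suc.IH)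
        (simp add: power2_eq_square power_mult[symmetric] mult_ac)
  qed simp
  moreover have "(\<lambda>N. (\<Prod>k<N. 1 - a * (r ^ 3) ^ k) * (\<Prod>k<N. 1 - a * r * (r ^ 3) ^ k) *
      (\<Prod>k<N. 1 - a * r\<^sup>2 * (r ^ 3) ^ k)) \<longlonglongrightarrow>
    qpoch_inf1 a (r ^ 3) * qpoch_inf1 (a * r) (r ^ 3) * qpoch_inf1 (a * r\<^sup>2) (r ^ 3)"
    by (intro tendsto_mult lim r3)
  ultimately show ?thesis
    using LIMSEQ_unique by simp
qed

lemma jtheta_log_sums:
  assumes "P \<noteq> 0" "norm P < 1" "z \<noteq> 0" "\<And>n::int. z * P powi n \<noteq> 1"
  shows "(\<lambda>m. z * P ^ m / (1 - z * P ^ m) - P / z * P ^ m / (1 - P / z * P ^ m)) sums jtheta_log P z"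
  unfolding jtheta_log_def
  using assms(1-3) powi_ne_1_cases[OF assms(1,3,4)] by (intro sums_diff lambert_sums) auto

section \<open>The identity in the variable $y$\<close>

locale nome =
  fixes p :: complex
  assumes p_nz: "p \<noteq> 0" and norm_p: "norm p < 1"
begin

definition base :: complex where "base = p ^ 6"

text \<open>The excluded points p^(-k - 6n) are at once the zeros of
  \<open>jtheta base (p ^ k * y)\<close>, for k >= 0, and the possible poles of the series with
  offset k.\<close>

definition reg :: "int \<Rightarrow> complex \<Rightarrow> bool" where
  "reg k y \<longleftrightarrow> (\<forall>n. y * p powi (6 * n + k) \<noteq> 1)"

definition generic :: "complex \<Rightarrow> bool" where
  "generic y \<longleftrightarrow> y \<noteq> 0 \<and> (\<forall>m. y * p powi m \<noteq> 1)"

lemma base_nz: "base \<noteq> 0" and norm_base: "norm base < 1" and norm_base_less: "norm base < norm p"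
proof -
  show "base \<noteq> 0" using p_nz by (simp add: base_def)
  have "norm p ^ 6 < norm p ^ 1"
    using p_nz norm_p by (intro power_strict_decreasing) auto
  then show "norm base < norm p" by (simp add: base_def norm_power)
  then show "norm base < 1" using norm_p by simp
qed

lemma base_powi: "base powi n = p powi (6 * n)"
  by (simp add: base_def power_int_mult)

lemma p_powi_eq_1_iff [simp]: "p powi m = 1 \<longleftrightarrow> m = 0"
proof
  assume "p powi m = 1"
  then have "norm p powi m = 1" by (metis norm_one norm_power_int)
  then show "m = 0"
    using p_nz norm_p power_int_strict_decreasing[of 0 m "norm p"] power_int_strict_decreasing[of m 0 "norm p"]
    by (cases m "0::int" rule: linorder_cases) auto
qed auto

lemma reg_powi [simp]: "reg k (p powi m) \<longleftrightarrow> \<not> 6 dvd (k + m)"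
proof -
  have "reg k (p powi m) \<longleftrightarrow> (\<forall>n. 6 * n + k + m \<noteq> 0)"
    using p_nz by (simp add: reg_def flip: power_int_add) (simp add: algebra_simps)
  also have "\<dots> \<longleftrightarrow> \<not> 6 dvd (k + m)" by presburger
  finally show ?thesis .
qed

lemma generic_imp_reg: "generic y \<Longrightarrow> reg k y"
  by (auto simp: generic_def reg_def)

lemma reg_mult:
  assumes "reg (int i) y"
  shows "p ^ i * y * base powi n \<noteq> 1"
proof -
  have eq: "y * p powi (6 * n + int i) = p ^ i * y * base powi n"
    using p_nz by (simp add: power_int_add base_powi)
  have "y * p powi (6 * n + int i) \<noteq> 1"
    using assms unfolding reg_def by (rule spec)
  then show ?thesis unfolding eq .
qed

lemma reg_1D: "reg 1 y \<Longrightarrow> p * y * base powi n \<noteq> 1"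
  and reg_3D: "reg 3 y \<Longrightarrow> p ^ 3 * y * base powi n \<noteq> 1"
  using reg_mult[of 1 y n] reg_mult[of 3 y n] by simp_all

text \<open>An annulus around |y| contains only finitely many powers of p. The centre y may itself
  be one, so identities at generic points determine the germ at every pole.\<close>

lemma eventually_generic:
  assumes "y \<noteq> 0"
  shows "\<forall>\<^sub>F z in at y. generic z"
proof -
  define r where "r = max (3 * norm y / 2) (2 / norm y)"
  have r: "r > 0" using assms by (auto simp: r_def less_max_iff_disj)
  define F where "F = (\<lambda>m. p powi m) ` {m. 1 / r \<le> norm (1 * p powi m) \<and> norm (1 * p powi m) \<le> r}"
  have "finite F"
    unfolding F_def by (intro finite_imageI finite_powi_between) (use p_nz norm_p r in auto)
  then have "\<forall>\<^sub>F z in at y. \<forall>x\<in>F. z \<noteq> x"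
    by (intro eventually_ball_finite) (auto intro: eventually_neq_at_within)
  moreover have "\<forall>\<^sub>F z in at y. z \<in> ball y (norm y / 2)"
    using assms by (intro eventually_at_in_open') auto
  ultimately show ?thesis
  proof eventually_elim
    case (elim z)
    have z: "norm y / 2 \<le> norm z" "norm z \<le> 3 * norm y / 2"
      using elim(2) norm_triangle_ineq2[of y z] norm_triangle_ineq2[of z y]
      by (auto simp: dist_norm norm_minus_commute)
    have "z \<noteq> 0" using z assms by auto
    moreover have "z * p powi m \<noteq> 1" for m
    proof
      assume "z * p powi m = 1"
      then have "z = p powi (-m)"
        using p_nz by (simp add: power_int_minus field_simps)
      moreover have "1 / r \<le> norm y / 2"
      proof -
        have "2 / norm y \<le> r" by (simp add: r_def)
        then show ?thesis using assms r by (simp add: field_simps)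
      qed
      then have "1 / r \<le> norm z" "norm z \<le> r" using z by (auto simp: r_def)
      ultimately have "z \<in> F" by (auto simp: F_def)
      then show False using elim(1) by auto
    qed
    ultimately show ?case by (simp add: generic_def)
  qed
qed

text \<open>Singularities can sit only at powers of p, and multiplication by \<open>base\<close>
  moves exponents by 6. The period -5..0 is chosen to contain the poles 0, -1, -2, -3 of the central
  terms.\<close>

lemma zero_if_removable:
  assumes shift: "\<And>y. generic y \<Longrightarrow> f (base * y) = - p * y * f y + K"
    and ana: "\<And>y. generic y \<Longrightarrow> f analytic_on {y}"
    and rem: "\<And>r. r \<in> {-5..0} \<Longrightarrow> removable_at f (p powi r)"
    and "generic y"
  shows "f y = 0"
proof (rule removable_shift_equation_imp_zero[where f = f and y = y and P = base and b = "- p" and K = K])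
  show ev: "\<forall>\<^sub>F w in at z. f (base * w) = - p * w * f w + K" if "z \<noteq> 0" for z
    using eventually_generic[OF that] by eventually_elim (rule shift)
  have scale: "removable_at f (base * z) \<longleftrightarrow> removable_at f z" if "z \<noteq> 0" for z
    by (rule removable_at_scale_iff[OF base_nz _ that ev[OF that]]) (use p_nz in auto)
  have step: "removable_at f (p powi (m + 6)) \<longleftrightarrow> removable_at f (p powi m)" for m
    using scale[of "p powi m"] p_nz by (simp add: power_int_add base_def mult.commute)
  have step': "removable_at f (p powi (6 * k + r)) \<longleftrightarrow> removable_at f (p powi r)" for k r
  proof (induction k rule: int_induct[of _ 0])
    case (step1 i)
    then show ?case using step[of "6 * i + r"] by (simp add: algebra_simps)
  next
    case (step2 i)
    then show ?case using step[of "6 * (i - 1) + r"] by (simp add: algebra_simps)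
  qed auto
  have all: "removable_at f (p powi m)" for m
  proof -
    have "m = 6 * ((m + 5) div 6) + ((m + 5) mod 6 - 5)" by presburger
    moreover have "(m + 5) mod 6 - 5 \<in> {-5..0}"
      using pos_mod_sign[of 6 "m + 5"] pos_mod_bound[of 6 "m + 5"] by auto
    ultimately show ?thesis using step' rem by metis
  qed
  show "removable_at f z" if "z \<noteq> 0" for z
  proof (cases "generic z")
    case True
    then show ?thesis by (intro removable_at_analytic ana)
  next
    case False
    then obtain m where "z * p powi m = 1" using \<open>z \<noteq> 0\<close> by (auto simp: generic_def)
    then have "z = p powi (- m)"
      using p_nz by (simp add: power_int_minus field_simps)
    then show ?thesis using all by simp
  qed
  show "isCont f y" using ana[OF assms(4)] by (rule analytic_at_imp_isCont)
qed (use assms(4) p_nz norm_p base_nz norm_base_less in \<open>auto simp: generic_def\<close>)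

subsection \<open>Appell--Lerch sums\<close>

text \<open>The three series of the theorem are, up to the factors p, 1 and p^2, the sums
  \<open>appell UNIV u d\<close> below with d = 2, 0, 3.\<close>

definition appell_weight :: "int \<Rightarrow> int \<Rightarrow> complex" where
  "appell_weight d n = (-1) powi n * p powi (3 * n\<^sup>2 + (2 + d) * n)"

definition appell :: "int set \<Rightarrow> (int \<Rightarrow> complex) \<Rightarrow> int \<Rightarrow> complex \<Rightarrow> complex" where
  "appell N u d y = (\<Sum>\<^sub>\<infinity>n\<in>N. u n * appell_weight d n / (1 - y * p powi (6 * n + d)))"

text \<open>Covers the constant multipliers and 6n + d alike, and is stable under n to n - 1; the
  quadratic exponent of the weights absorbs it.\<close>

definition lin_growth :: "(int \<Rightarrow> complex) \<Rightarrow> bool" where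
  "lin_growth u \<longleftrightarrow> (\<exists>C. \<forall>n. norm (u n) \<le> C * (\<bar>real_of_int n\<bar> + 1))"

lemma lin_growth_affine: "lin_growth (\<lambda>n. of_int (a * n + b))"
  unfolding lin_growth_def
proof (intro exI allI)
  fix n
  have "\<bar>real_of_int (a * n + b)\<bar> \<le> \<bar>real_of_int a\<bar> * \<bar>real_of_int n\<bar> + \<bar>real_of_int b\<bar>"
    by (simp flip: abs_mult)
  also have "\<dots> \<le> (\<bar>real_of_int a\<bar> + \<bar>real_of_int b\<bar>) * (\<bar>real_of_int n\<bar> + 1)"
    by (simp add: algebra_simps)
  finally show "norm (of_int (a * n + b) :: complex) \<le> (\<bar>real_of_int a\<bar> + \<bar>real_of_int b\<bar>) * (\<bar>real_of_int n\<bar> + 1)"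
    by (simp only: norm_of_int)
qed

lemma lin_growth_1: "lin_growth (\<lambda>_. 1)"
  using lin_growth_affine[of 0 1] by simp

lemma summable_appell_weight:
  assumes "lin_growth u"
  shows "(\<lambda>n. norm (u n * appell_weight d n)) summable_on N"
proof -
  obtain C where C: "\<And>n. norm (u n) \<le> C * (\<bar>real_of_int n\<bar> + 1)"
    using assms by (auto simp: lin_growth_def)
  have "(\<lambda>n. C * ((\<bar>real_of_int n\<bar> + 1) * norm p powi (3 * n\<^sup>2 + (2 + d) * n + 0))) summable_on UNIV"
    by (intro summable_on_cmult_right summable_on_quadratic_powi) (use p_nz norm_p in auto)
  then have "(\<lambda>n. norm (u n * appell_weight d n)) summable_on UNIV"
    by (rule summable_on_comparison_test)
      (use C in \<open>auto simp: appell_weight_def norm_mult norm_power_int simp flip: mult.assoc intro!: mult_right_mono\<close>)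
  then show ?thesis by (rule summable_on_subset_banach) auto
qed

lemma
  assumes "lin_growth u" "y \<noteq> 0" "\<And>n. n \<in> N \<Longrightarrow> y * p powi (6 * n + d) \<noteq> 1"
  shows appell_analytic_on_subset: "appell N u d analytic_on {y}"
    and appell_summable: "(\<lambda>n. u n * appell_weight d n / (1 - y * p powi (6 * n + d))) summable_on N"
proof -
  have fin: "finite {n \<in> N. 1 / r \<le> norm (p powi (6 * n + d)) \<and> norm (p powi (6 * n + d)) \<le> r}" if "r > 0" for r
  proof -
    have "finite {n. 1 / r \<le> norm (p powi d * base powi n) \<and> norm (p powi d * base powi n) \<le> r}"
      by (rule finite_powi_between) (use that base_nz norm_base p_nz in auto)
    then show ?thesis
      by (rule rev_finite_subset) (use p_nz in \<open>auto simp: base_powi power_int_add mult.commute\<close>)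
  qed
  show "appell N u d analytic_on {y}"
    unfolding appell_def using summable_appell_weight[OF assms(1)] fin assms(2,3)
    by (rule partial_fractions_analytic)
  show "(\<lambda>n. u n * appell_weight d n / (1 - y * p powi (6 * n + d))) summable_on N"
    using summable_appell_weight[OF assms(1)] fin assms(2,3)
    by (rule partial_fractions_summable)
qed

lemma appell_analytic: "lin_growth u \<Longrightarrow> y \<noteq> 0 \<Longrightarrow> reg d y \<Longrightarrow> appell UNIV u d analytic_on {y}"
  by (rule appell_analytic_on_subset) (auto simp: reg_def)

lemma appell_rest_analytic:
  assumes "lin_growth u"
  shows "appell (-{0}) u d analytic_on {p powi (-d)}"
  by (rule appell_analytic_on_subset[OF assms]) (use p_nz in \<open>auto simp flip: power_int_add\<close>)

text \<open>Only the term n = 0 is isolated, since the functional equation carries p^(-d) to all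
  other poles. Its weight is 1, so its numerator is \<open>u 0\<close>.\<close>

lemma appell_pole:
  assumes "lin_growth u" "generic y"
  shows "appell UNIV u d y = u 0 / (1 - p powi d * y) + appell (-{0}) u d y"
proof -
  have "(\<lambda>n. u n * appell_weight d n / (1 - y * p powi (6 * n + d))) summable_on N" for N
    by (rule appell_summable) (use assms in \<open>auto simp: generic_def\<close>)
  then have "appell ({0} \<union> -{0}) u d y = appell {0} u d y + appell (-{0}) u d y"
    unfolding appell_def by (intro infsum_Un_disjoint) auto
  then show ?thesis
    by (simp add: appell_def appell_weight_def Un_commute mult.commute flip: insert_is_Un)
qed

text \<open>The coefficient 2 + d in the exponent makes the factor -p the same for every d, and
  equal to the one of the theta quotient.\<close>

lemma appell_weight_shift: "appell_weight d (n - 1) * p powi (6 * n + d) = - p * appell_weight d n"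
proof -
  have "(-1) powi (n - 1) = - ((-1) powi n :: complex)"
    by (simp add: power_int_diff)
  moreover have "p powi (3 * (n - 1)\<^sup>2 + (2 + d) * (n - 1)) * p powi (6 * n + d) = p powi (3 * n\<^sup>2 + (2 + d) * n) * p"
  proof -
    have "3 * (n - 1)\<^sup>2 + (2 + d) * (n - 1) + (6 * n + d) = 3 * n\<^sup>2 + (2 + d) * n + 1"
      by (simp add: power2_eq_square algebra_simps)
    then show ?thesis using p_nz by (simp flip: power_int_add power_int_add_1)
  qed
  ultimately show ?thesis by (simp add: appell_weight_def)
qed

lemma lin_growth_shift: "lin_growth u \<Longrightarrow> lin_growth (\<lambda>n. u (n - 1))"
  unfolding lin_growth_def
proof (elim exE)
  fix C assume C: "\<forall>n. norm (u n) \<le> C * (\<bar>real_of_int n\<bar> + 1)"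
  have "0 \<le> C" using spec[OF C, of 0] norm_ge_zero[of "u 0"] by (simp del: norm_ge_zero)
  show "\<exists>C. \<forall>n. norm (u (n - 1)) \<le> C * (\<bar>real_of_int n\<bar> + 1)"
  proof (intro exI allI)
    fix n
    have "norm (u (n - 1)) \<le> C * (\<bar>real_of_int (n - 1)\<bar> + 1)" using C by blast
    also have "\<dots> \<le> C * (2 * (\<bar>real_of_int n\<bar> + 1))"
      using \<open>0 \<le> C\<close> by (intro mult_left_mono) auto
    finally show "norm (u (n - 1)) \<le> (2 * C) * (\<bar>real_of_int n\<bar> + 1)" by (simp add: mult_ac)
  qed
qed

text \<open>The factor p^6 in the argument is absorbed by n to n - 1. What does not recombine into
  the series is a sum free of y, the future constant K.\<close>

lemma appell_shift:
  assumes u: "lin_growth u" and y: "generic y"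
  shows "appell UNIV u d (base * y) =
    (\<Sum>\<^sub>\<infinity>n. u n * appell_weight d n) - p * y * appell UNIV (\<lambda>n. u (n - 1)) d y"
proof -
  have bij: "bij_betw (\<lambda>n::int. n - 1) UNIV UNIV"
    by (rule bij_betwI[of _ _ _ "\<lambda>n. n + 1"]) auto
  have summ: "(\<lambda>n. u n * appell_weight d n) summable_on UNIV"
    using summable_appell_weight[OF u] by (rule abs_summable_summable)
  have "appell UNIV u d (base * y) = (\<Sum>\<^sub>\<infinity>n. u (n - 1) * appell_weight d (n - 1) / (1 - base * y * p powi (6 * (n - 1) + d)))"
    unfolding appell_def by (rule infsum_reindex_bij_betw[OF bij, symmetric])
  also have "\<dots> = (\<Sum>\<^sub>\<infinity>n. u (n - 1) * appell_weight d (n - 1) +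
      - p * y * (u (n - 1) * appell_weight d n / (1 - y * p powi (6 * n + d))))"
  proof (rule infsum_cong)
    fix n :: int
    have b: "base * y * p powi (6 * (n - 1) + d) = y * p powi (6 * n + d)"
    proof -
      have "p powi (6 * n + d) = p powi ((6 * (n - 1) + d) + 6)" by simp
      also have "\<dots> = p powi (6 * (n - 1) + d) * base"
        using p_nz by (subst power_int_add) (auto simp: base_def)
      finally show ?thesis by simp
    qed
    have nz: "1 - y * p powi (6 * n + d) \<noteq> 0" using y by (simp add: generic_def)
    \<comment> \<open>This is 1/(1 - w) = 1 + w/(1 - w) with w = y p^(6n + d): the 1 feeds the
      constant, and w meets \<open>appell_weight_shift\<close>.\<close>
    have "u (n - 1) * appell_weight d (n - 1) / (1 - y * p powi (6 * n + d)) =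
      u (n - 1) * appell_weight d (n - 1) + y * u (n - 1) * (appell_weight d (n - 1) * p powi (6 * n + d)) / (1 - y * p powi (6 * n + d))"
      using nz by (simp add: field_simps)
    then show "u (n - 1) * appell_weight d (n - 1) / (1 - base * y * p powi (6 * (n - 1) + d)) =
      u (n - 1) * appell_weight d (n - 1) + - p * y * (u (n - 1) * appell_weight d n / (1 - y * p powi (6 * n + d)))"
      unfolding b appell_weight_shift by (simp add: mult_ac)
  qed
  also have "\<dots> = (\<Sum>\<^sub>\<infinity>n. u (n - 1) * appell_weight d (n - 1)) +
      (\<Sum>\<^sub>\<infinity>n. - p * y * (u (n - 1) * appell_weight d n / (1 - y * p powi (6 * n + d))))"
  proof (rule infsum_add)
    show "(\<lambda>n. u (n - 1) * appell_weight d (n - 1)) summable_on UNIV"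
      using summ by (subst summable_on_reindex_bij_betw[OF bij])
    show "(\<lambda>n. - p * y * (u (n - 1) * appell_weight d n / (1 - y * p powi (6 * n + d)))) summable_on UNIV"
      by (intro summable_on_cmult_right appell_summable lin_growth_shift u) (use y in \<open>auto simp: generic_def\<close>)
  qed
  also have "(\<Sum>\<^sub>\<infinity>n. u (n - 1) * appell_weight d (n - 1)) = (\<Sum>\<^sub>\<infinity>n. u n * appell_weight d n)"
    by (rule infsum_reindex_bij_betw[OF bij])
  finally show ?thesis unfolding infsum_cmult_right' appell_def by simp
qed

lemma appell_linear:
  assumes "lin_growth u" "lin_growth v" "generic y"
  shows "appell UNIV (\<lambda>n. u n + c * v n) d y = appell UNIV u d y + c * appell UNIV v d y"
proof -
  have s: "(\<lambda>n. w n * appell_weight d n / (1 - y * p powi (6 * n + d))) summable_on UNIV" if "lin_growth w" for w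
    by (rule appell_summable[OF that]) (use assms in \<open>auto simp: generic_def\<close>)
  have "appell UNIV (\<lambda>n. u n + c * v n) d y =
    (\<Sum>\<^sub>\<infinity>n. u n * appell_weight d n / (1 - y * p powi (6 * n + d)) + c * (v n * appell_weight d n / (1 - y * p powi (6 * n + d))))"
    unfolding appell_def by (rule infsum_cong) (simp add: ring_distribs add_divide_distrib mult_ac)
  also have "\<dots> = appell UNIV u d y + c * appell UNIV v d y"
    unfolding appell_def
    by (subst infsum_add) (simp_all only: infsum_cmult_right' s assms summable_on_cmult_right)
  finally show ?thesis .
qed

subsection \<open>Comparing the theta quotient with the Appell--Lerch sums\<close>

abbreviation jt where "jt \<equiv> jtheta base"
abbreviation jl where "jl \<equiv> jtheta_log base"
abbreviation euler where "euler \<equiv> qpoch_inf1 base base"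

definition quot :: "complex \<Rightarrow> complex" where
  "quot y = jt (p * y) * jt (p\<^sup>2) * euler\<^sup>2 / (jt y * jt p * jt (p\<^sup>2 * y))"

text \<open>The sum over m in the theorem, its six terms paired into three theta logarithms. The
  weights 1 and 2 of those depending on y add up to the drop by 3.\<close>

definition logsum :: "complex \<Rightarrow> complex" where
  "logsum y = jl p - jl (p * y) - 2 * jl (p ^ 3 * y)"

lemma reg_1_iff [simp]: "reg k 1 \<longleftrightarrow> \<not> 6 dvd k"
  using reg_powi[of k 0] by simp

lemma jt_nonzero:
  assumes "y \<noteq> 0" "reg (int i) y"
  shows "jt (p ^ i * y) \<noteq> 0"
  using assms p_nz by (intro jtheta_nonzero base_nz norm_base reg_mult) auto

lemma jt_p_nonzero: "jt p \<noteq> 0" and jt_p2_nonzero: "jt (p\<^sup>2) \<noteq> 0"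
  using jt_nonzero[of 1 1] jt_nonzero[of 1 2] by auto

lemma euler_nonzero: "euler \<noteq> 0"
  by (intro qpoch_inf1_nonzero norm_base nome_power_ne_1)

lemma quot_analytic:
  assumes "y \<noteq> 0" "reg 0 y" "reg 2 y"
  shows "quot analytic_on {y}"
proof -
  have "jt y \<noteq> 0" "jt (p\<^sup>2 * y) \<noteq> 0"
    using jt_nonzero[of y 0] jt_nonzero[of y 2] assms by auto
  then show ?thesis
    unfolding quot_def using assms p_nz norm_base jt_p_nonzero by (intro analytic_intros) auto
qed

lemma jl_analytic:
  assumes "y \<noteq> 0" "reg (int i) y"
  shows "(\<lambda>y. jl (p ^ i * y)) analytic_on {y}"
  using assms p_nz reg_mult[OF assms(2)]
  by (intro jtheta_log_analytic analytic_intros base_nz norm_base) auto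

lemma jl1_analytic: "y \<noteq> 0 \<Longrightarrow> reg 1 y \<Longrightarrow> (\<lambda>y. jl (p * y)) analytic_on {y}"
  using jl_analytic[of y 1] by simp

lemma jl3_analytic: "y \<noteq> 0 \<Longrightarrow> reg 3 y \<Longrightarrow> (\<lambda>y. jl (p ^ 3 * y)) analytic_on {y}"
  using jl_analytic[of y 3] by simp

lemma logsum_analytic:
  assumes "y \<noteq> 0" "reg 1 y" "reg 3 y"
  shows "logsum analytic_on {y}"
  unfolding logsum_def using assms by (intro analytic_intros jl1_analytic jl3_analytic) auto

lemma quot_shift:
  assumes "y \<noteq> 0"
  shows "quot (base * y) = - p * y * quot y"
proof -
  have "jt (base * z) = - jt z / z" if "z \<noteq> 0" for z
    using that by (intro jtheta_shift base_nz norm_base)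
  from this[of y] this[of "p * y"] this[of "p\<^sup>2 * y"]
  have "jt (base * y) = - jt y / y" "jt (p * (base * y)) = - jt (p * y) / (p * y)"
    "jt (p\<^sup>2 * (base * y)) = - jt (p\<^sup>2 * y) / (p\<^sup>2 * y)"
    using assms p_nz by (auto simp: mult_ac)
  then show ?thesis
    using assms p_nz by (simp add: quot_def) (simp add: field_simps power2_eq_square)
qed

lemma logsum_shift:
  assumes "generic y"
  shows "logsum (base * y) = logsum y - 3"
proof -
  have y: "y \<noteq> 0" using assms by (simp add: generic_def)
  have "jl (base * (p ^ i * y)) = jl (p ^ i * y) + 1" for i
    by (intro jtheta_log_shift base_nz norm_base reg_mult generic_imp_reg assms) (use y p_nz in auto)
  from this[of 1] this[of 3] show ?thesis
    by (simp add: logsum_def mult_ac)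
qed

definition err1 :: "complex \<Rightarrow> complex" where
  "err1 y = quot y - appell UNIV (\<lambda>_. 1) 0 y - p * appell UNIV (\<lambda>_. 1) 2 y"

text \<open>The factor that makes the poles at p^(-3) cancel in \<open>err2\<close>; it turns out to be
  p^2 times the coefficient of the third series (\<open>res3_eq\<close>).\<close>

definition res3 :: complex where "res3 = - 4 * quot (p powi -3)"

text \<open>The unsimplified \<open>6 * n + 0\<close> keeps the shape a n + b that the lemmas on
  affine multipliers expect.\<close>

definition err2 :: "complex \<Rightarrow> complex" where
  "err2 y = 2 * logsum y * quot y - appell UNIV (\<lambda>n. of_int (6 * n + 0)) 0 y
    - p * appell UNIV (\<lambda>n. of_int (6 * n + 2)) 2 y - res3 * appell UNIV (\<lambda>_. 1) 3 y"

lemmas lg = lin_growth_1 lin_growth_affine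

lemma err1_analytic:
  assumes "y \<noteq> 0" "reg 0 y" "reg 2 y"
  shows "err1 analytic_on {y}"
  unfolding err1_def using assms by (intro analytic_intros quot_analytic appell_analytic lg)

lemma err2_analytic:
  assumes "y \<noteq> 0" "reg 0 y" "reg 1 y" "reg 2 y" "reg 3 y"
  shows "err2 analytic_on {y}"
  unfolding err2_def using assms
  by (intro analytic_intros quot_analytic logsum_analytic appell_analytic lg)

lemma err1_shift: "\<exists>K. \<forall>y. generic y \<longrightarrow> err1 (base * y) = - p * y * err1 y + K"
proof (rule exI, intro allI impI)
  fix y assume y: "generic y"
  show "err1 (base * y) = - p * y * err1 y + (- (\<Sum>\<^sub>\<infinity>n. 1 * appell_weight 0 n) - p * (\<Sum>\<^sub>\<infinity>n. 1 * appell_weight 2 n))"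
    using y unfolding err1_def appell_shift[OF lin_growth_1 y]
    by (subst quot_shift) (auto simp: generic_def algebra_simps)
qed

lemma appell_affine_shift:
  assumes "generic y"
  shows "appell UNIV (\<lambda>n. of_int (6 * (n - 1) + b)) d y =
    appell UNIV (\<lambda>n. of_int (6 * n + b)) d y - 6 * appell UNIV (\<lambda>_. 1) d y"
  using appell_linear[OF lin_growth_affine lin_growth_1 assms, of 6 b "-6" d]
  by (simp add: algebra_simps)

text \<open>The drop of 2 \<open>logsum\<close> and the drop of both affine multipliers are each 6,
  which assembles to 6 \<open>err1\<close>; the third series has a constant multiplier and adds
  nothing to it.\<close>

lemma err2_shift: "\<exists>K. \<forall>y. generic y \<longrightarrow> err2 (base * y) = - p * y * (err2 y - 6 * err1 y) + K"
proof (rule exI, intro allI impI)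
  fix y assume y: "generic y"
  show "err2 (base * y) = - p * y * (err2 y - 6 * err1 y) + (- (\<Sum>\<^sub>\<infinity>n. of_int (6 * n + 0) * appell_weight 0 n)
    - p * (\<Sum>\<^sub>\<infinity>n. of_int (6 * n + 2) * appell_weight 2 n) - res3 * (\<Sum>\<^sub>\<infinity>n. 1 * appell_weight 3 n))"
    using y unfolding err2_def err1_def appell_shift[OF lin_growth_1 y] appell_shift[OF lin_growth_affine y]
      appell_affine_shift[OF y] logsum_shift[OF y]
    by (subst quot_shift) (auto simp: generic_def algebra_simps)
qed

section \<open>Cancellation of the poles at p^0, p^(-1), p^(-2), p^(-3)\<close>

definition quot0 :: "complex \<Rightarrow> complex" where
  "quot0 y = jt (p * y) * jt (p\<^sup>2) * euler\<^sup>2 / (jtheta_regular base y * jt p * jt (p\<^sup>2 * y))"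

definition quot2 :: "complex \<Rightarrow> complex" where
  "quot2 y = jt (p * y) * jt (p\<^sup>2) * euler\<^sup>2 / (jt y * jt p * jtheta_regular base (p\<^sup>2 * y))"

lemma quot_eq_quot0: "quot y = quot0 y / (1 - y)"
  by (simp add: quot_def quot0_def jtheta_split[OF norm_base, of y])

lemma quot_eq_quot2: "quot y = quot2 y / (1 - p\<^sup>2 * y)"
  by (simp add: quot_def quot2_def jtheta_split[OF norm_base, of "p\<^sup>2 * y"])

lemma jtheta_regular_1: "jtheta_regular base 1 = euler\<^sup>2"
  by (simp add: jtheta_regular_def power2_eq_square)

lemma quot0_analytic: "quot0 analytic_on {1}"
proof -
  have "jtheta_regular base 1 * jt p * jt (p\<^sup>2 * 1) \<noteq> 0"
    using jt_p_nonzero jt_p2_nonzero euler_nonzero by (simp add: jtheta_regular_1)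
  then show ?thesis
    unfolding quot0_def using p_nz norm_base by (intro analytic_intros) auto
qed

lemma quot0_1: "quot0 1 = 1"
  using jt_p_nonzero jt_p2_nonzero euler_nonzero by (simp add: quot0_def jtheta_regular_1)

text \<open>The constant \<open>jl p\<close> cancels \<open>jl (p * y)\<close> at y = 1, and p^3 is
  a square root of \<open>base\<close>, so the two Lambert series in \<open>jl (p ^ 3)\<close>
  coincide.\<close>

lemma logsum_1: "logsum 1 = 0"
proof -
  have "base / p ^ 3 = p ^ 3"
    using p_nz by (simp add: base_def divide_eq_eq flip: power_add)
  then show ?thesis by (simp add: logsum_def jtheta_log_def)
qed

text \<open>The residue data are \<open>quot0 1 = 1\<close> against the central term of the series d
  = 0, and 2 \<open>logsum 1\<close> = 0 against its multiplier 6 * 0 + 0.\<close>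

lemma removable_1: "removable_at err1 1" "removable_at err2 1"
proof -
  have ev: "\<forall>\<^sub>F y in at 1. generic y" by (rule eventually_generic) simp
  show "removable_at err1 1"
  proof (rule removable_at_simple_pole[where s = 1])
    show "(\<lambda>y. quot0 y - 1) analytic_on {1}"
      by (intro analytic_intros quot0_analytic)
    show "(\<lambda>y. - appell (-{0}) (\<lambda>_. 1) 0 y - p * appell UNIV (\<lambda>_. 1) 2 y) analytic_on {1}"
      using appell_rest_analytic[of "\<lambda>_. 1" 0]
      by (intro analytic_intros appell_analytic lg) (auto intro: lg)
    show "\<forall>\<^sub>F y in at 1. err1 y = (quot0 y - 1) / (1 - 1 * y) +
        (- appell (-{0}) (\<lambda>_. 1) 0 y - p * appell UNIV (\<lambda>_. 1) 2 y)"
      using ev by eventually_elim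
        (simp add: err1_def quot_eq_quot0 appell_pole[OF lin_growth_1, of _ 0] diff_divide_distrib)
  qed (auto simp: quot0_1)
  show "removable_at err2 1"
  proof (rule removable_at_simple_pole[where s = 1])
    show "(\<lambda>y. 2 * logsum y * quot0 y) analytic_on {1}"
      by (intro analytic_intros quot0_analytic logsum_analytic) auto
    show "(\<lambda>y. - appell (-{0}) (\<lambda>n. of_int (6 * n + 0)) 0 y - p * appell UNIV (\<lambda>n. of_int (6 * n + 2)) 2 y
        - res3 * appell UNIV (\<lambda>_. 1) 3 y) analytic_on {1}"
      using appell_rest_analytic[of "\<lambda>n. of_int (6 * n + 0)" 0, OF lin_growth_affine]
      by (intro analytic_intros appell_analytic lg) (auto intro: lg)
    show "\<forall>\<^sub>F y in at 1. err2 y = 2 * logsum y * quot0 y / (1 - 1 * y) +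
        (- appell (-{0}) (\<lambda>n. of_int (6 * n + 0)) 0 y - p * appell UNIV (\<lambda>n. of_int (6 * n + 2)) 2 y
        - res3 * appell UNIV (\<lambda>_. 1) 3 y)"
      using ev
    proof eventually_elim
      case (elim y)
      show ?case
        unfolding err2_def quot_eq_quot0 appell_pole[OF lin_growth_affine elim, of 6 0 0] by simp
    qed
  qed (auto simp: logsum_1)
qed

lemma removable_2:
  assumes a: "a = p powi -2"
  shows "removable_at err1 a" "removable_at err2 a"
proof -
  have a0: "a \<noteq> 0" and pa: "p\<^sup>2 * a = 1" and pa': "p * a = 1 / p" and a': "a = 1 / p\<^sup>2"
    using p_nz by (auto simp: a power_int_minus field_simps power2_eq_square)
  have reg_a: "reg k a \<longleftrightarrow> \<not> 6 dvd (k - 2)" for k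
    using reg_powi[of k "-2"] unfolding a by simp
  have ev: "\<forall>\<^sub>F y in at a. generic y" by (rule eventually_generic) fact
  have jta: "jt a \<noteq> 0" using jt_nonzero[of a 0] a0 reg_a by simp
  have ana: "quot2 analytic_on {a}"
  proof -
    have "jt a * jt p * jtheta_regular base (p\<^sup>2 * a) \<noteq> 0"
      unfolding pa using jt_p_nonzero jta euler_nonzero by (simp add: jtheta_regular_1)
    then show ?thesis
      unfolding quot2_def using p_nz norm_base a0 by (intro analytic_intros) auto
  qed
  \<comment> \<open>Inversion z to 1/z cancels all thetas and leaves p, the prefactor of the series
    d = 2.\<close>
  have quot2_a: "quot2 a = p"
  proof -
    have *: "jt (p * a) = - jt p / p" "jt a = - jt (p\<^sup>2) / p\<^sup>2"
      unfolding pa' unfolding a' using p_nz by (intro jtheta_inverse base_nz norm_base; simp)+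
    then show ?thesis
      unfolding quot2_def pa jtheta_regular_1 * using jt_p_nonzero jt_p2_nonzero euler_nonzero p_nz
      by (simp add: field_simps power2_eq_square)
  qed
  \<comment> \<open>Here p a = 1/p and p^3 a = p, so the inversion formula cancels every
    \<open>jl p\<close>; 2 \<open>logsum a\<close> is then the multiplier 6 * 0 + 2.\<close>
  have logsum_a: "logsum a = 1"
  proof -
    have "jl (1 / p) = - jl p - 1"
      using reg_mult[of 1 1] by (intro jtheta_log_inverse base_nz norm_base p_nz) auto
    moreover have "p ^ 3 * a = p" using pa by (simp add: power3_eq_cube power2_eq_square mult_ac)
    ultimately show ?thesis by (simp add: logsum_def pa')
  qed
  have ana2: "appell (-{0}) u 2 analytic_on {a}" if "lin_growth u" for u
    unfolding a using that by (rule appell_rest_analytic)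
  show "removable_at err1 a"
  proof (rule removable_at_simple_pole[where s = "p\<^sup>2"])
    show "(\<lambda>y. quot2 y - p) analytic_on {a}"
      by (intro analytic_intros ana)
    show "(\<lambda>y. - appell UNIV (\<lambda>_. 1) 0 y - p * appell (-{0}) (\<lambda>_. 1) 2 y) analytic_on {a}"
      by (intro analytic_intros appell_analytic ana2 lg) (auto simp: a0 reg_a)
    show "\<forall>\<^sub>F y in at a. err1 y = (quot2 y - p) / (1 - p\<^sup>2 * y) +
        (- appell UNIV (\<lambda>_. 1) 0 y - p * appell (-{0}) (\<lambda>_. 1) 2 y)"
      using ev by eventually_elim
        (simp add: err1_def quot_eq_quot2 appell_pole[OF lin_growth_1, of _ 2] diff_divide_distrib algebra_simps)
  qed (auto simp: quot2_a pa)
  show "removable_at err2 a"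
  proof (rule removable_at_simple_pole[where s = "p\<^sup>2"])
    show "(\<lambda>y. 2 * logsum y * quot2 y - 2 * p) analytic_on {a}"
      by (intro analytic_intros ana logsum_analytic) (auto simp: a0 reg_a)
    show "(\<lambda>y. - appell UNIV (\<lambda>n. of_int (6 * n + 0)) 0 y - p * appell (-{0}) (\<lambda>n. of_int (6 * n + 2)) 2 y
        - res3 * appell UNIV (\<lambda>_. 1) 3 y) analytic_on {a}"
      by (intro analytic_intros appell_analytic ana2 lg) (auto simp: a0 reg_a)
    show "\<forall>\<^sub>F y in at a. err2 y = (2 * logsum y * quot2 y - 2 * p) / (1 - p\<^sup>2 * y) +
        (- appell UNIV (\<lambda>n. of_int (6 * n + 0)) 0 y - p * appell (-{0}) (\<lambda>n. of_int (6 * n + 2)) 2 y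
        - res3 * appell UNIV (\<lambda>_. 1) 3 y)"
      using ev
    proof eventually_elim
      case (elim y)
      show ?case
        unfolding err2_def quot_eq_quot2 appell_pole[OF lin_growth_affine elim, of 6 2 2]
        by (simp add: diff_divide_distrib algebra_simps)
    qed
  qed (auto simp: quot2_a pa logsum_a)
qed

lemma generic_imp_nome_power_ne_1: "generic y \<Longrightarrow> p ^ i * y * base ^ m \<noteq> 1"
  using reg_mult[OF generic_imp_reg, of y i "int m"] by (simp add: power_int_of_nat)

text \<open>The polar part of -2 \<open>jl (p ^ 3 * y)\<close>, multiplied by 2 \<open>quot\<close>,
  has numerator -4 p^3 y \<open>quot y\<close>. At p^3 y = 1 this is \<open>res3\<close>, the
  numerator of the central term of the third series.\<close>

lemma err2_removable_3:
  assumes a: "a = p powi -3"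
  shows "removable_at err2 a"
proof -
  have a0: "a \<noteq> 0" and pa: "p ^ 3 * a = 1"
    using p_nz by (auto simp: a power_int_minus)
  have reg_a: "reg k a \<longleftrightarrow> \<not> 6 dvd (k - 3)" for k
    using reg_powi[of k "-3"] unfolding a by simp
  have ev: "\<forall>\<^sub>F y in at a. generic y" by (rule eventually_generic) fact
  have ana3: "appell (-{0}) u 3 analytic_on {a}" if "lin_growth u" for u
    unfolding a using that by (rule appell_rest_analytic)
  show ?thesis
  proof (rule removable_at_simple_pole[where s = "p ^ 3"])
    show "(\<lambda>y. - 4 * (p ^ 3 * y) * quot y - res3) analytic_on {a}"
      by (intro analytic_intros quot_analytic) (auto simp: a0 reg_a)
    show "(\<lambda>y. 2 * quot y * (jl p - jl (p * y) - 2 * jtheta_log_regular base (p ^ 3 * y))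
        - appell UNIV (\<lambda>n. of_int (6 * n + 0)) 0 y - p * appell UNIV (\<lambda>n. of_int (6 * n + 2)) 2 y
        - res3 * appell (-{0}) (\<lambda>_. 1) 3 y) analytic_on {a}"
      by (intro analytic_intros quot_analytic jl1_analytic jtheta_log_regular_analytic appell_analytic ana3 lg base_nz norm_base)
        (auto simp: a0 reg_a pa)
    show "\<forall>\<^sub>F y in at a. err2 y = (- 4 * (p ^ 3 * y) * quot y - res3) / (1 - p ^ 3 * y) +
        (2 * quot y * (jl p - jl (p * y) - 2 * jtheta_log_regular base (p ^ 3 * y))
        - appell UNIV (\<lambda>n. of_int (6 * n + 0)) 0 y - p * appell UNIV (\<lambda>n. of_int (6 * n + 2)) 2 y
        - res3 * appell (-{0}) (\<lambda>_. 1) 3 y)"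
      using ev
    proof eventually_elim
      case (elim y)
      have "jl (p ^ 3 * y) = p ^ 3 * y / (1 - p ^ 3 * y) + jtheta_log_regular base (p ^ 3 * y)"
        using elim p_nz by (intro jtheta_log_split base_nz norm_base generic_imp_nome_power_ne_1) (auto simp: generic_def)
      then show ?case
        using elim by (simp add: err2_def logsum_def appell_pole[OF lin_growth_1, of _ 3] diff_divide_distrib algebra_simps)
    qed
  qed (auto simp: pa res3_def simp flip: a)
qed

text \<open>No series has a pole here: the pole of \<open>jl (p * y)\<close> meets the zero of
  \<open>jt (p * y)\<close> in the numerator of \<open>quot\<close>.\<close>

lemma err2_removable_1:
  assumes a: "a = p powi -1"
  shows "removable_at err2 a"
proof -
  have a0: "a \<noteq> 0" and pa: "p * a = 1"
    using p_nz by (auto simp: a power_int_minus)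
  have reg_a: "reg k a \<longleftrightarrow> \<not> 6 dvd (k - 1)" for k
    using reg_powi[of k "-1"] unfolding a by simp
  have ev: "\<forall>\<^sub>F y in at a. generic y" by (rule eventually_generic) fact
  show ?thesis
  proof (rule removable_at_simple_pole[where s = p])
    show "(\<lambda>y. - 2 * (p * y) * quot y) analytic_on {a}"
      by (intro analytic_intros quot_analytic) (auto simp: a0 reg_a)
    show "(\<lambda>y. 2 * quot y * (jl p - jtheta_log_regular base (p * y) - 2 * jl (p ^ 3 * y))
        - appell UNIV (\<lambda>n. of_int (6 * n + 0)) 0 y - p * appell UNIV (\<lambda>n. of_int (6 * n + 2)) 2 y
        - res3 * appell UNIV (\<lambda>_. 1) 3 y) analytic_on {a}"
      by (intro analytic_intros quot_analytic jl3_analytic jtheta_log_regular_analytic appell_analytic lg base_nz norm_base)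
        (auto simp: a0 reg_a pa)
    show "\<forall>\<^sub>F y in at a. err2 y = (- 2 * (p * y) * quot y) / (1 - p * y) +
        (2 * quot y * (jl p - jtheta_log_regular base (p * y) - 2 * jl (p ^ 3 * y))
        - appell UNIV (\<lambda>n. of_int (6 * n + 0)) 0 y - p * appell UNIV (\<lambda>n. of_int (6 * n + 2)) 2 y
        - res3 * appell UNIV (\<lambda>_. 1) 3 y)"
      using ev
    proof eventually_elim
      case (elim y)
      have "jl (p * y) = p * y / (1 - p * y) + jtheta_log_regular base (p * y)"
        using elim p_nz generic_imp_nome_power_ne_1[OF elim, of 1]
        by (intro jtheta_log_split base_nz norm_base) (auto simp: generic_def)
      then show ?case
        by (simp add: err2_def logsum_def algebra_simps)
    qed
    show "- 2 * (p * a) * quot a = 0"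
      by (simp add: quot_def pa jtheta_1 norm_base)
  qed (rule pa)
qed

lemma err1_eq_0:
  assumes "generic y"
  shows "err1 y = 0"
proof -
  obtain K where K: "\<And>y. generic y \<Longrightarrow> err1 (base * y) = - p * y * err1 y + K"
    using err1_shift by blast
  show ?thesis
  proof (rule zero_if_removable[OF K _ _ assms])
    show "err1 analytic_on {y}" if "generic y" for y
      using that by (intro err1_analytic generic_imp_reg) (auto simp: generic_def)
    fix r :: int assume "r \<in> {-5..0}"
    then consider "r = 0" | "r = -2" | "r \<in> {-5, -4, -3, -1}" by force
    then show "removable_at err1 (p powi r)"
    proof cases
      case 3
      then show ?thesis
        using p_nz by (intro removable_at_analytic err1_analytic) auto
    qed (use removable_1 removable_2 in auto)
  qed
qed

lemma err2_eq_0: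
  assumes "generic y"
  shows "err2 y = 0"
proof -
  obtain K where K: "\<And>y. generic y \<Longrightarrow> err2 (base * y) = - p * y * (err2 y - 6 * err1 y) + K"
    using err2_shift by blast
  \<comment> \<open>Vanishing of \<open>err1\<close> must come first: it closes the equation for
    \<open>err2\<close>.\<close>
  have K': "err2 (base * y) = - p * y * err2 y + K" if "generic y" for y
    using K[OF that] err1_eq_0[OF that] by simp
  show ?thesis
  proof (rule zero_if_removable[OF K' _ _ assms])
    show "err2 analytic_on {y}" if "generic y" for y
      using that by (intro err2_analytic generic_imp_reg) (auto simp: generic_def)
    fix r :: int assume "r \<in> {-5..0}"
    then consider "r = 0" | "r = -1" | "r = -2" | "r = -3" | "r \<in> {-5, -4}" by force
    then show "removable_at err2 (p powi r)"
    proof cases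
      case 5
      then show ?thesis
        using p_nz by (intro removable_at_analytic err2_analytic) auto
    qed (use removable_1 removable_2 err2_removable_3 err2_removable_1 in auto)
  qed
qed

text \<open>In nome p^6, (p^2; p^2) splits into exponents 2, 4, 6 and (p; p^2) into 1, 3, 5, which
  are theta values; the inversion formula brings \<open>quot\<close> at p^(-3) to the same ones. The
  factor p^2 becomes the q^(2l) of the third series.\<close>

lemma res3_eq: "res3 = p\<^sup>2 * (4 * (qpoch_inf1 (p\<^sup>2) (p\<^sup>2))\<^sup>2 / (qpoch_inf1 p (p\<^sup>2))\<^sup>2)"
proof -
  have p2: "norm (p\<^sup>2) < 1" using norm_p by (simp add: norm_power power_less_one_iff)
  have b: "(p\<^sup>2) ^ 3 = base" by (simp add: base_def flip: power_mult)
  have q: "base / p\<^sup>2 = p ^ 4" "base / p = p ^ 5" "base / p ^ 3 = p ^ 3"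
    using p_nz by (simp_all add: base_def divide_eq_eq flip: power_add power_Suc2)
  have "qpoch_inf1 (p\<^sup>2) (p\<^sup>2) = jt (p\<^sup>2) * euler"
    unfolding jtheta_def qpoch_inf1_trisect[OF p2, of "p\<^sup>2"] b q
    by (simp add: base_def flip: power_add)
  moreover have "(qpoch_inf1 p (p\<^sup>2))\<^sup>2 = jt (p ^ 3) * (jt p)\<^sup>2"
  proof -
    have "p * p\<^sup>2 = p ^ 3" "p * (p\<^sup>2)\<^sup>2 = p ^ 5"
      by (simp_all add: power2_eq_square eval_nat_numeral)
    then show ?thesis
      unfolding jtheta_def qpoch_inf1_trisect[OF p2, of p] b q
      by (simp add: power2_eq_square mult_ac)
  qed
  moreover have "res3 = 4 * p\<^sup>2 * (jt (p\<^sup>2) * euler)\<^sup>2 / (jt (p ^ 3) * (jt p)\<^sup>2)"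
  proof -
    have inv: "jt (1 / z) = - jt z / z" if "z \<noteq> 0" for z
      using that by (intro jtheta_inverse base_nz norm_base)
    have a: "p powi -3 = 1 / p ^ 3" "p * (1 / p ^ 3) = 1 / p\<^sup>2" "p\<^sup>2 * (1 / p ^ 3) = 1 / p"
      using p_nz by (auto simp: power_int_minus field_simps eval_nat_numeral)
    have jts: "jt (1 / p ^ 3) = - jt (p ^ 3) / p ^ 3" "jt (1 / p\<^sup>2) = - jt (p\<^sup>2) / p\<^sup>2" "jt (1 / p) = - jt p / p"
      by (simp_all add: inv p_nz)
    have "jt (p ^ 3) \<noteq> 0" using jt_nonzero[of 1 3] by simp
    then show ?thesis
      unfolding res3_def a quot_def a jts using p_nz jt_p_nonzero
      by (simp add: field_simps) (simp add: eval_nat_numeral)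
  qed
  ultimately show ?thesis by simp
qed

lemma logsum_sums:
  assumes "generic y"
  shows "(\<lambda>m. (p * base ^ m / (1 - p * base ^ m) - base / p * base ^ m / (1 - base / p * base ^ m))
    - (p * y * base ^ m / (1 - p * y * base ^ m) - base / (p * y) * base ^ m / (1 - base / (p * y) * base ^ m))
    - 2 * (p ^ 3 * y * base ^ m / (1 - p ^ 3 * y * base ^ m) - base / (p ^ 3 * y) * base ^ m / (1 - base / (p ^ 3 * y) * base ^ m)))
    sums logsum y"
proof -
  have y: "y \<noteq> 0" using assms by (simp add: generic_def)
  show ?thesis
    unfolding logsum_def
    using reg_mult[of 1 1] reg_1D reg_3D generic_imp_reg[OF assms] y p_nz
    by (intro sums_diff sums_mult jtheta_log_sums base_nz norm_base) auto
qed

text \<open>This is \<open>J * err1 y + err2 y = 0\<close>, with J still independent of y.\<close>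

lemma main_identity:
  assumes "generic y"
  shows "quot y * (J + 2 * logsum y) =
    p * appell UNIV (\<lambda>n. of_int (6 * n + 2) + J * 1) 2 y + appell UNIV (\<lambda>n. of_int (6 * n + 0) + J * 1) 0 y
    + res3 * appell UNIV (\<lambda>_. 1) 3 y"
  using err1_eq_0[OF assms] err2_eq_0[OF assms]
  unfolding appell_linear[OF lin_growth_affine lin_growth_1 assms] err1_def err2_def
  by algebra

end

section \<open>Specialisation to p = q^l, y = -q^j, J = j\<close>

theorem theorem5:
  fixes l j :: int and q :: complex
  assumes "l > 0" and "0 < norm q" and "norm q < 1"
  shows
    "qbracket_inf [- (q powi (l + j)), q powi (2*l)] (q powi (6*l))
        * (qpoch_inf [q powi (6*l)] (q powi (6*l)))\<^sup>2
      / qbracket_inf [- (q powi j), q powi l, - (q powi (2*l + j))] (q powi (6*l))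
      * (of_int j + 2 * (\<Sum>m::nat.
            q powi (6*l*int m + l) / (1 - q powi (6*l*int m + l))
          - q powi (6*l*int m + 5*l) / (1 - q powi (6*l*int m + 5*l))
          + q powi (6*l*int m + l + j) / (1 + q powi (6*l*int m + l + j))
          - q powi (6*l*int m + 5*l - j) / (1 + q powi (6*l*int m + 5*l - j))
          - 2 * (q powi (6*l*int m + 3*l - j) / (1 + q powi (6*l*int m + 3*l - j)))
          + 2 * (q powi (6*l*int m + 3*l + j) / (1 + q powi (6*l*int m + 3*l + j)))))
     = (\<Sum>\<^sub>\<infinity>n::int. of_int (6*n + 2 + j) * (-1) powi n * q powi (3*l*n*(n+1) + l*n + l)
            / (1 + q powi (6*l*n + j + 2*l)))
     + (\<Sum>\<^sub>\<infinity>n::int. of_int (6*n + j) * (-1) powi n * q powi (3*l*n*(n+1) - l*n)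
            / (1 + q powi (6*l*n + j)))
     + 4 * (qpoch_inf [q powi (2*l)] (q powi (2*l)))\<^sup>2
         / (qpoch_inf [q powi l] (q powi (2*l)))\<^sup>2
       * (\<Sum>\<^sub>\<infinity>n::int. (-1) powi n * q powi (3*l*n*(n+1) + 2*l*n + 2*l)
            / (1 + q powi (6*l*n + j + 3*l)))"
proof -
  have q: "q \<noteq> 0" using assms by auto
  define p where "p = q powi l"
  define x where "x = q powi j"
  have x: "x \<noteq> 0" using q by (simp add: x_def)
  interpret nome p
  proof
    show "p \<noteq> 0" using q by (simp add: p_def)
    show "norm p < 1"
      using assms power_int_strict_decreasing[of 0 l "norm q"] by (simp add: p_def norm_power_int)
  qed
  have q_powi: "q powi (l * a + j * b) = p powi a * x powi b" for a b
    using q by (simp add: p_def x_def power_int_add power_int_mult)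
  \<comment> \<open>Although q^j may be a power of p, -q^j never is: q^k = -1 would give |q|^k = 1,
    so k = 0 and 1 = -1.\<close>
  have generic: "generic (- x)"
  proof -
    have "- x * p powi m \<noteq> 1" for m
    proof
      assume eq: "- x * p powi m = 1"
      have "q powi (j + l * m) = - 1"
        using q_powi[of m 1] eq by (simp add: add.commute minus_equation_iff mult.commute)
      then have "norm q powi (j + l * m) = 1"
        by (metis norm_minus_cancel norm_one norm_power_int)
      then have "j + l * m = 0"
        using assms power_int_strict_decreasing[of 0 "j + l * m" "norm q"]
          power_int_strict_decreasing[of "j + l * m" 0 "norm q"]
        by (cases "j + l * m" "0::int" rule: linorder_cases) auto
      with \<open>q powi (j + l * m) = - 1\<close> show False by simp
    qed
    then show ?thesis using x by (simp add: generic_def)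
  qed
  have base: "q powi (6 * l) = base"
    using q_powi[of 6 0] by (simp add: base_def mult.commute)
  have p2: "q powi (2 * l) = p\<^sup>2"
    using q_powi[of 2 0] by (simp add: mult.commute)
  have px: "- (q powi (l + j)) = p * - x" "- (q powi (2 * l + j)) = p\<^sup>2 * - x"
    using q_powi[of 1 1] q_powi[of 2 1] by (simp_all add: mult.commute)
  have prod: "qbracket_inf [- (q powi (l + j)), q powi (2*l)] (q powi (6*l))
        * (qpoch_inf [q powi (6*l)] (q powi (6*l)))\<^sup>2
      / qbracket_inf [- (q powi j), q powi l, - (q powi (2*l + j))] (q powi (6*l)) = quot (- x)"
    unfolding px p2 base by (simp add: qbracket_inf_eq_jtheta qpoch_inf_def quot_def mult_ac flip: p_def x_def)

  \<comment> \<open>With y = -x the denominators 1 + ... become 1 - ..., and exponents with 5l, 5l -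
    j, 3l - j belong to \<open>base / z\<close> for z = p, p y, p^3 y, the partners in
    \<open>jtheta_log\<close>.\<close>
  have powers: "q powi (6 * l * int m + l) = p * base ^ m"
      "q powi (6 * l * int m + 5 * l) = base / p * base ^ m"
      "q powi (6 * l * int m + l + j) = - (p * - x * base ^ m)"
      "q powi (6 * l * int m + 5 * l - j) = - (base / (p * - x) * base ^ m)"
      "q powi (6 * l * int m + 3 * l - j) = - (base / (p ^ 3 * - x) * base ^ m)"
      "q powi (6 * l * int m + 3 * l + j) = - (p ^ 3 * - x * base ^ m)" for m
  proof -
    have *: "q powi (6 * l * int m + (l * a + j * b)) = p powi a * x powi b * base ^ m" for a b
    proof -
      have "q powi (6 * l * int m) = base ^ m"
        unfolding power_int_mult[of q "6 * l"] base by simp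
      then show ?thesis using q by (simp add: power_int_add[of _ "6 * l * int m"] q_powi)
    qed
    show "q powi (6 * l * int m + l) = p * base ^ m"
      using *[of 1 0] by simp
    show "q powi (6 * l * int m + 5 * l) = base / p * base ^ m"
      using *[of 5 0] p_nz by (simp add: base_def mult.commute eval_nat_numeral)
    show "q powi (6 * l * int m + l + j) = - (p * - x * base ^ m)"
      using *[of 1 1] by (simp add: add.assoc)
    show "q powi (6 * l * int m + 5 * l - j) = - (base / (p * - x) * base ^ m)"
      using *[of 5 "-1"] p_nz x by (simp add: base_def power_int_minus field_simps eval_nat_numeral)
    show "q powi (6 * l * int m + 3 * l - j) = - (base / (p ^ 3 * - x) * base ^ m)"
      using *[of 3 "-1"] p_nz x by (simp add: base_def power_int_minus field_simps eval_nat_numeral)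
    show "q powi (6 * l * int m + 3 * l + j) = - (p ^ 3 * - x * base ^ m)"
      using *[of 3 1] by (simp add: add.assoc mult.commute)
  qed
  have sum: "(\<Sum>m::nat.
            q powi (6*l*int m + l) / (1 - q powi (6*l*int m + l))
          - q powi (6*l*int m + 5*l) / (1 - q powi (6*l*int m + 5*l))
          + q powi (6*l*int m + l + j) / (1 + q powi (6*l*int m + l + j))
          - q powi (6*l*int m + 5*l - j) / (1 + q powi (6*l*int m + 5*l - j))
          - 2 * (q powi (6*l*int m + 3*l - j) / (1 + q powi (6*l*int m + 3*l - j)))
          + 2 * (q powi (6*l*int m + 3*l + j) / (1 + q powi (6*l*int m + 3*l + j)))) = logsum (- x)"
    unfolding powers sums_unique[OF logsum_sums[OF generic]]
    by (intro suminf_cong) (simp add: algebra_simps)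

  \<comment> \<open>All three series at once, with (b, d, c) = (1, 2, 1), (-1, 0, 0), (2, 3, 2). The
    relation b = d - 1 turns 3n(n+1) + b n into the weight exponent 3n^2 + (2 + d) n.\<close>
  have series: "(\<Sum>\<^sub>\<infinity>n::int. u n * (-1) powi n * q powi (3 * l * n * (n + 1) + b * l * n + c * l) / (1 + q powi (6 * l * n + j + d * l)))
      = p powi c * appell UNIV u d (- x)" if "b = d - 1" for u b c d
  proof -
    have "q powi (3 * l * n * (n + 1) + b * l * n + c * l) = p powi c * p powi (3 * n\<^sup>2 + (2 + d) * n)" for n
    proof -
      have "3 * l * n * (n + 1) + b * l * n + c * l = l * (c + (3 * n\<^sup>2 + (2 + d) * n)) + j * 0"
        by (simp add: that algebra_simps power2_eq_square)
      then have "q powi (3 * l * n * (n + 1) + b * l * n + c * l) = q powi (l * (c + (3 * n\<^sup>2 + (2 + d) * n)) + j * 0)"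
        by (rule arg_cong)
      then show ?thesis unfolding q_powi using p_nz by (simp add: power_int_add)
    qed
    moreover have "q powi (6 * l * n + j + d * l) = p powi (6 * n + d) * x" for n
    proof -
      have "6 * l * n + j + d * l = l * (6 * n + d) + j * 1" by (simp add: algebra_simps)
      then show ?thesis by (simp only: q_powi) simp
    qed
    ultimately show ?thesis
      unfolding appell_def infsum_cmult_right'[symmetric]
      by (intro infsum_cong) (simp add: appell_weight_def mult_ac)
  qed
  have "(\<Sum>\<^sub>\<infinity>n::int. of_int (6*n + 2 + j) * (-1) powi n * q powi (3*l*n*(n+1) + l*n + l)
            / (1 + q powi (6*l*n + j + 2*l))) = p * appell UNIV (\<lambda>n. of_int (6 * n + 2) + of_int j * 1) 2 (- x)"
    using series[of 1 2 "\<lambda>n. of_int (6 * n + 2) + of_int j * 1" 1] by simp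
  moreover have "(\<Sum>\<^sub>\<infinity>n::int. of_int (6*n + j) * (-1) powi n * q powi (3*l*n*(n+1) - l*n)
            / (1 + q powi (6*l*n + j))) = appell UNIV (\<lambda>n. of_int (6 * n + 0) + of_int j * 1) 0 (- x)"
    using series[of "-1" 0 "\<lambda>n. of_int (6 * n + 0) + of_int j * 1" 0] by simp
  moreover have "(\<Sum>\<^sub>\<infinity>n::int. (-1) powi n * q powi (3*l*n*(n+1) + 2*l*n + 2*l)
            / (1 + q powi (6*l*n + j + 3*l))) = p\<^sup>2 * appell UNIV (\<lambda>_. 1) 3 (- x)"
    using series[of 2 3 "\<lambda>_. 1" 2] by simp
  moreover have "qpoch_inf [q powi (2*l)] (q powi (2*l)) = qpoch_inf1 (p\<^sup>2) (p\<^sup>2)"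
      "qpoch_inf [q powi l] (q powi (2*l)) = qpoch_inf1 p (p\<^sup>2)"
    unfolding p2 by (simp_all add: qpoch_inf_def p_def)
  ultimately show ?thesis
    unfolding prod sum main_identity[OF generic] res3_eq by (simp add: mult_ac)
qed

end
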